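(* Let $G$ be a group acting transitively from the left on a set $\Omega$, let $\omega_0\in\Omega$, let $H=G_{\omega_0}$ be the stabiliser of $\omega_0$, and let $E=H\backslash G/H$. Fix data $\sigma$, $(P_f)_{f\in E}$, $(Q_{f,f'})_{f,f'\in E}$, $E_+$, $\leq$ as described in the context, and let $F$ be the free group with basis $X=\{x_f: f\in E_+\setminus\{e\}\}$, with $x_e:=1$ and $x_f:=x_{\bar f}^{-1}$ for $f\in E\setminus E_+$. Then the group $G$ is generated by the free product $H\ast F$ modulo the type (I) relations $$h\,x_f=x_f\,\iota_f(h)\qquad(f\in E_+\setminus\{e\},\ h\in H_f)$$ together with the type (II) relations $$x_f\,h\,x_{f'}=\rho_g\,x_{C(g)}\,\lambda_g\qquad(f,f'\in E\setminus\{e\},\ \bar f\leq f',\ h\in Q_{\bar f,f'},\ g=\sigma(f)h\sigma(f')).$$ That is, the homomorphism $H\ast F\to G$ which is the inclusion on $H$ and sends $x_f\mapsto\sigma(f)$ $(f\in E_+\setminus\{e\})$ is surjective, and its kernel is the normal closure of the elements expressing these relations.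
   Context: For $g\in G$ write $C(g)=HgH\in E=H\backslash G/H$. Put $e=C(1)=H$ and $\overline{C(g)}=C(g^{-1})$; this is an involution on $E$. Section: $\sigma:E\to G$ is a section of the projection $G\to E$, $g\mapsto C(g)$, such that $\sigma(e)=1$, $\sigma(\bar f)=\sigma(f)^{-1}$ if $\bar f\neq f$, and $\sigma(f)^2\in H$ if $\bar f=f$. For $f\in E$ put $H_f=H\cap\sigma(f)H\sigma(f)^{-1}$ and let $\iota_f:H_f\to H_{\bar f}$ be the isomorphism $\iota_f(h)=\sigma(f)^{-1}h\sigma(f)$. Transversals: for each $f\in E$, $P_f\subseteq H$ is a set of representatives of the left cosets $hH_f$ of $H_f$ in $H$, with $1\in P_f$. Every $g\in G$ then has a unique normal form $g=\rho_g\,\sigma(C(g))\,\lambda_g$ with $\rho_g\in P_{C(g)}$, $\lambda_g\in H$. Double coset representatives: for each $(f,f')\in E\times E$, $Q_{f,f'}\subseteq H$ is a set of pairwise inequivalent representatives of the double cosets $H_f h H_{f'}$ in $H_f\backslash H/H_{f'}$, with $1\in Q_{f,f'}$ and with $Q_{f',f}=Q_{f,f'}^{-1}=\{q^{-1}:q\in Q_{f,f'}\}$ whenever $f\neq f'$. Orientation: $E_+\subseteq E$ is a subset such that $E$ is the disjoint union of $E_+$ and $\{\bar f: f\in E_+,\ f\neq\bar f\}$ (so $e\in E_+$). Order: $\leq$ is a total order on the set $E\setminus\{e\}$. *)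

theory Defs
  imports "HOL-Algebra.Group_Action"
begin

section \<open>Monoids presented by generators and relations\<close>

inductive_set word_cong :: "'a set \<Rightarrow> ('a list \<times> 'a list) set \<Rightarrow> ('a list \<times> 'a list) set"
  for A R where
  base: "(u, v) \<in> R \<Longrightarrow> u \<in> lists A \<Longrightarrow> v \<in> lists A \<Longrightarrow> (u, v) \<in> word_cong A R"
| refl: "u \<in> lists A \<Longrightarrow> (u, u) \<in> word_cong A R"
| sym: "(u, v) \<in> word_cong A R \<Longrightarrow> (v, u) \<in> word_cong A R"
| trans: "(u, v) \<in> word_cong A R \<Longrightarrow> (v, w) \<in> word_cong A R \<Longrightarrow> (u, w) \<in> word_cong A R"
| append: "(u, u') \<in> word_cong A R \<Longrightarrow> (v, v') \<in> word_cong A R \<Longrightarrow> (u @ v, u' @ v') \<in> word_cong A R"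

definition word_class :: "'a set \<Rightarrow> ('a list \<times> 'a list) set \<Rightarrow> 'a list \<Rightarrow> 'a list set" where
  "word_class A R w = word_cong A R `` {w}"

definition presented_monoid :: "'a set \<Rightarrow> ('a list \<times> 'a list) set \<Rightarrow> 'a list set monoid" where
  "presented_monoid A R =
    \<lparr>carrier = lists A // word_cong A R,
     monoid.mult = (\<lambda>U V. \<Union>u\<in>U. \<Union>v\<in>V. word_class A R (u @ v)),
     one = word_class A R []\<rparr>"

lemma word_cong_lists: "(u, v) \<in> word_cong A R \<Longrightarrow> u \<in> lists A \<and> v \<in> lists A"
  by (induction rule: word_cong.induct) auto

lemma equiv_word_cong: "equiv (lists A) (word_cong A R)"
proof (rule equivI)
  show "word_cong A R \<subseteq> lists A \<times> lists A" using word_cong_lists by fastforce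
  show "refl_on (lists A) (word_cong A R)" by (auto simp: refl_on_def intro: word_cong.refl)
  show "Relation.sym (word_cong A R)" by (auto simp: sym_def intro: word_cong.sym)
  show "Relation.trans (word_cong A R)" by (auto simp: trans_def intro: word_cong.trans)
qed

lemma word_class_eqI: "(u, v) \<in> word_cong A R \<Longrightarrow> word_class A R u = word_class A R v"
  unfolding word_class_def by (rule equiv_class_eq[OF equiv_word_cong])

lemma word_class_eq_iff:
  "u \<in> lists A \<Longrightarrow> v \<in> lists A \<Longrightarrow> word_class A R u = word_class A R v \<longleftrightarrow> (u, v) \<in> word_cong A R"
  unfolding word_class_def by (rule eq_equiv_class_iff[OF equiv_word_cong])

lemma carrier_presented_monoid: "carrier (presented_monoid A R) = word_class A R ` lists A"
  by (auto simp: presented_monoid_def quotient_def word_class_def)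

lemma one_presented_monoid: "\<one>\<^bsub>presented_monoid A R\<^esub> = word_class A R []"
  by (simp add: presented_monoid_def)

lemma mult_presented_monoid:
  assumes "u \<in> lists A" "v \<in> lists A"
  shows "word_class A R u \<otimes>\<^bsub>presented_monoid A R\<^esub> word_class A R v = word_class A R (u @ v)"
proof -
  have *: "word_class A R (u' @ v') = word_class A R (u @ v)"
    if "u' \<in> word_class A R u" "v' \<in> word_class A R v" for u' v'
    using that by (intro word_class_eqI word_cong.append) (auto simp: word_class_def intro: word_cong.sym)
  have "u \<in> word_class A R u" "v \<in> word_class A R v"
    using assms by (auto simp: word_class_def intro: word_cong.refl)
  with * have "(\<Union>u'\<in>word_class A R u. \<Union>v'\<in>word_class A R v. word_class A R (u' @ v')) =
      word_class A R (u @ v)" by blast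
  then show ?thesis by (simp add: presented_monoid_def)
qed

lemma append_mem_lists: "u \<in> lists A \<Longrightarrow> v \<in> lists A \<Longrightarrow> u @ v \<in> lists A"
  by simp

lemma monoid_presented_monoid: "monoid (presented_monoid A R)"
proof (rule monoidI)
  let ?M = "presented_monoid A R"
  note C = carrier_presented_monoid[of A R] and M = mult_presented_monoid append_mem_lists
  show "\<one>\<^bsub>?M\<^esub> \<in> carrier ?M" unfolding C one_presented_monoid by blast
  fix x assume "x \<in> carrier ?M"
  then obtain u where u: "x = word_class A R u" "u \<in> lists A" unfolding C by blast
  have nil: "[] \<in> lists A" by simp
  show "\<one>\<^bsub>?M\<^esub> \<otimes>\<^bsub>?M\<^esub> x = x" "x \<otimes>\<^bsub>?M\<^esub> \<one>\<^bsub>?M\<^esub> = x"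
    by (simp_all only: u(1) one_presented_monoid M(1)[OF nil u(2)] M(1)[OF u(2) nil]
        append_Nil append_Nil2)
  fix y assume "y \<in> carrier ?M"
  then obtain v where v: "y = word_class A R v" "v \<in> lists A" unfolding C by blast
  show "x \<otimes>\<^bsub>?M\<^esub> y \<in> carrier ?M"
    unfolding C u(1) v(1) M(1)[OF u(2) v(2)] by (intro imageI M(2) u v)
  fix z assume "z \<in> carrier ?M"
  then obtain w where w: "z = word_class A R w" "w \<in> lists A" unfolding C by blast
  show "x \<otimes>\<^bsub>?M\<^esub> y \<otimes>\<^bsub>?M\<^esub> z = x \<otimes>\<^bsub>?M\<^esub> (y \<otimes>\<^bsub>?M\<^esub> z)"
    by (simp only: u(1) v(1) w(1) M(1) M(2) u(2) v(2) w(2) append_assoc)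
qed

lemma group_presented_monoid:
  assumes inv: "\<And>a. a \<in> A \<Longrightarrow> \<exists>b\<in>A. ([b, a], []) \<in> word_cong A R"
  shows "group (presented_monoid A R)"
proof -
  interpret monoid "presented_monoid A R" by (rule monoid_presented_monoid)
  have *: "\<exists>v\<in>lists A. (v @ u, []) \<in> word_cong A R" if "u \<in> lists A" for u
    using that
  proof (induction u)
    case Nil
    then show ?case by (auto intro: word_cong.refl)
  next
    case (Cons a u)
    then obtain b v where b: "b \<in> A" "([b, a], []) \<in> word_cong A R"
      and v: "v \<in> lists A" "(v @ u, []) \<in> word_cong A R" using inv by blast
    have "(v @ ([b, a] @ u), v @ ([] @ u)) \<in> word_cong A R"
      using b v Cons by (intro word_cong.append word_cong.refl) auto
    then have "((v @ [b]) @ a # u, []) \<in> word_cong A R"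
      using v(2) by (auto intro: word_cong.trans)
    then show ?case using b v by (intro bexI[of _ "v @ [b]"]) auto
  qed
  have "\<exists>y\<in>carrier (presented_monoid A R). y \<otimes>\<^bsub>presented_monoid A R\<^esub> x = \<one>\<^bsub>presented_monoid A R\<^esub>"
    if x: "x \<in> carrier (presented_monoid A R)" for x
  proof -
    obtain u where u: "x = word_class A R u" "u \<in> lists A"
      using x unfolding carrier_presented_monoid by blast
    then obtain v where v: "v \<in> lists A" "(v @ u, []) \<in> word_cong A R" using * by blast
    then have "word_class A R v \<otimes>\<^bsub>presented_monoid A R\<^esub> x = \<one>\<^bsub>presented_monoid A R\<^esub>"
      unfolding u(1) mult_presented_monoid[OF v(1) u(2)] one_presented_monoid
      by (intro word_class_eqI)
    then show ?thesis using v(1) unfolding carrier_presented_monoid by blast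
  qed
  then show ?thesis by (intro groupI m_closed one_closed m_assoc l_one)
qed

lemma presented_monoid_lift:
  assumes M: "monoid M" and j: "\<And>a. a \<in> A \<Longrightarrow> j a \<in> carrier M"
    and R: "\<And>u v. (u, v) \<in> R \<Longrightarrow> u \<in> lists A \<Longrightarrow> v \<in> lists A \<Longrightarrow>
      foldr (\<lambda>a m. j a \<otimes>\<^bsub>M\<^esub> m) u \<one>\<^bsub>M\<^esub> = foldr (\<lambda>a m. j a \<otimes>\<^bsub>M\<^esub> m) v \<one>\<^bsub>M\<^esub>"
  obtains \<theta> where "\<theta> \<in> hom (presented_monoid A R) M"
    and "\<And>u. u \<in> lists A \<Longrightarrow> \<theta> (word_class A R u) = foldr (\<lambda>a m. j a \<otimes>\<^bsub>M\<^esub> m) u \<one>\<^bsub>M\<^esub>"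
proof -
  interpret monoid M by (rule M)
  define ev where "ev u = foldr (\<lambda>a m. j a \<otimes>\<^bsub>M\<^esub> m) u \<one>\<^bsub>M\<^esub>" for u
  have ev_closed: "ev u \<in> carrier M" if "u \<in> lists A" for u
    using that unfolding ev_def by (induction u) (auto simp: j)
  have ev_append: "ev (u @ v) = ev u \<otimes>\<^bsub>M\<^esub> ev v" if "u \<in> lists A" "v \<in> lists A" for u v
    using that(1)
  proof (induction u)
    case Nil
    then show ?case using ev_closed[OF that(2)] by (simp add: ev_def)
  next
    case (Cons a u)
    have "ev (a # w) = j a \<otimes>\<^bsub>M\<^esub> ev w" for w by (simp add: ev_def)
    then show ?case using Cons ev_closed that(2) j by (simp add: m_assoc)
  qed
  have ev_cong: "ev u = ev v" if "(u, v) \<in> word_cong A R" for u v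
    using that
  proof (induction rule: word_cong.induct)
    case (base u v)
    then show ?case using R by (simp add: ev_def)
  next
    case (append u u' v v')
    then show ?case using word_cong_lists by (metis ev_append)
  qed auto
  define \<theta> where "\<theta> U = ev (SOME u. u \<in> U)" for U
  have \<theta>: "\<theta> (word_class A R u) = ev u" if "u \<in> lists A" for u
  proof -
    have "u \<in> word_class A R u" using that by (auto simp: word_class_def intro: word_cong.refl)
    then have "(SOME v. v \<in> word_class A R u) \<in> word_class A R u" by (rule someI)
    then show ?thesis unfolding \<theta>_def word_class_def using ev_cong by force
  qed
  have "\<theta> \<in> hom (presented_monoid A R) M"
  proof (rule homI)
    fix x assume "x \<in> carrier (presented_monoid A R)"
    then obtain u where u: "x = word_class A R u" "u \<in> lists A"
      unfolding carrier_presented_monoid by blast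
    show "\<theta> x \<in> carrier M" unfolding u(1) \<theta>[OF u(2)] by (rule ev_closed[OF u(2)])
    fix y assume "y \<in> carrier (presented_monoid A R)"
    then obtain v where v: "y = word_class A R v" "v \<in> lists A"
      unfolding carrier_presented_monoid by blast
    show "\<theta> (x \<otimes>\<^bsub>presented_monoid A R\<^esub> y) = \<theta> x \<otimes>\<^bsub>M\<^esub> \<theta> y"
      by (simp only: u v \<theta> mult_presented_monoid append_mem_lists ev_append)
  qed
  then show ?thesis using that \<theta> by (simp add: ev_def)
qed

section \<open>Free groups and free products\<close>

text \<open>The letter \<open>(x, True)\<close> stands for the basis element \<open>x\<close> and \<open>(x, False)\<close> for its inverse.\<close>

definition free_group :: "'a set \<Rightarrow> ('a \<times> bool) list set monoid" where
  "free_group X = presented_monoid (X \<times> UNIV) {([(x, b), (x, \<not> b)], []) | x b. x \<in> X}"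

definition free_gen :: "'a set \<Rightarrow> 'a \<Rightarrow> ('a \<times> bool) list set" where
  "free_gen X x =
    word_class (X \<times> UNIV) {([(x, b), (x, \<not> b)], []) | x b. x \<in> X} [(x, True)]"

definition free_product_rels ::
    "('a, 'm) monoid_scheme \<Rightarrow> ('b, 'n) monoid_scheme \<Rightarrow> (('a + 'b) list \<times> ('a + 'b) list) set" where
  "free_product_rels A B =
    {([Inl \<one>\<^bsub>A\<^esub>], []), ([Inr \<one>\<^bsub>B\<^esub>], [])} \<union>
    {([Inl a, Inl a'], [Inl (a \<otimes>\<^bsub>A\<^esub> a')]) | a a'. a \<in> carrier A \<and> a' \<in> carrier A} \<union>
    {([Inr b, Inr b'], [Inr (b \<otimes>\<^bsub>B\<^esub> b')]) | b b'. b \<in> carrier B \<and> b' \<in> carrier B}"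

definition free_product ::
    "('a, 'm) monoid_scheme \<Rightarrow> ('b, 'n) monoid_scheme \<Rightarrow> ('a + 'b) list set monoid" where
  "free_product A B = presented_monoid (carrier A <+> carrier B) (free_product_rels A B)"

definition fp_inl ::
    "('a, 'm) monoid_scheme \<Rightarrow> ('b, 'n) monoid_scheme \<Rightarrow> 'a \<Rightarrow> ('a + 'b) list set" where
  "fp_inl A B a = word_class (carrier A <+> carrier B) (free_product_rels A B) [Inl a]"

definition fp_inr ::
    "('a, 'm) monoid_scheme \<Rightarrow> ('b, 'n) monoid_scheme \<Rightarrow> 'b \<Rightarrow> ('a + 'b) list set" where
  "fp_inr A B b = word_class (carrier A <+> carrier B) (free_product_rels A B) [Inr b]"

lemma group_free_group: "group (free_group X)"
  unfolding free_group_def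
proof (rule group_presented_monoid)
  fix a :: "'a \<times> bool" assume "a \<in> X \<times> UNIV"
  then obtain x b where [simp]: "a = (x, b)" "x \<in> X" by auto
  have "([(x, \<not> b), (x, \<not> \<not> b)], []) \<in> {([(x, b), (x, \<not> b)], []) | x b. x \<in> X}" by force
  then have "([(x, \<not> b), a], []) \<in> word_cong (X \<times> UNIV) {([(x, b), (x, \<not> b)], []) | x b. x \<in> X}"
    by (intro word_cong.base) auto
  then show "\<exists>c\<in>X \<times> UNIV. ([c, a], []) \<in> word_cong (X \<times> UNIV) {([(x, b), (x, \<not> b)], []) | x b. x \<in> X}"
    by (intro bexI[of _ "(x, \<not> b)"]) auto
qed

lemma free_group_lift:
  assumes M: "group M" and j: "\<And>x. x \<in> X \<Longrightarrow> j x \<in> carrier M"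
  obtains \<theta> where "\<theta> \<in> hom (free_group X) M" and "\<And>x. x \<in> X \<Longrightarrow> \<theta> (free_gen X x) = j x"
proof -
  interpret group M by (rule M)
  obtain \<theta> where "\<theta> \<in> hom (free_group X) M" and
    \<theta>: "\<And>u. u \<in> lists (X \<times> UNIV) \<Longrightarrow>
      \<theta> (word_class (X \<times> UNIV) {([(x, b), (x, \<not> b)], []) | x b. x \<in> X} u) =
      foldr (\<lambda>(x, b) m. (if b then j x else inv\<^bsub>M\<^esub> j x) \<otimes>\<^bsub>M\<^esub> m) u \<one>\<^bsub>M\<^esub>"
    unfolding free_group_def
    by (rule presented_monoid_lift[OF monoid_axioms,
          where A = "X \<times> UNIV" and R = "{([(x, b), (x, \<not> b)], []) | x b. x \<in> X}"
            and j = "\<lambda>(x, b). if b then j x else inv\<^bsub>M\<^esub> j x"])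
       (auto simp: j case_prod_unfold split: if_splits)
  moreover have "\<theta> (free_gen X x) = j x" if "x \<in> X" for x
    unfolding free_gen_def using that j by (subst \<theta>) auto
  ultimately show ?thesis using that by blast
qed

lemma group_free_product:
  assumes "group A" "group B"
  shows "group (free_product A B)"
  unfolding free_product_def
proof (rule group_presented_monoid)
  interpret A: group A by fact
  interpret B: group B by fact
  let ?S = "carrier A <+> carrier B" and ?R = "free_product_rels A B"
  fix c assume "c \<in> ?S"
  then consider a where "c = Inl a" "a \<in> carrier A" | b where "c = Inr b" "b \<in> carrier B" by auto
  then show "\<exists>d\<in>?S. ([d, c], []) \<in> word_cong ?S ?R"
  proof cases
    case (1 a)
    then have "([Inl (inv\<^bsub>A\<^esub> a), Inl a], [Inl (inv\<^bsub>A\<^esub> a \<otimes>\<^bsub>A\<^esub> a)]) \<in> ?R"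
      unfolding free_product_rels_def by (blast intro: A.inv_closed)
    with 1 have "([Inl (inv\<^bsub>A\<^esub> a), c], [Inl \<one>\<^bsub>A\<^esub>]) \<in> word_cong ?S ?R"
      by (intro word_cong.base) auto
    moreover have "([Inl \<one>\<^bsub>A\<^esub>], []) \<in> word_cong ?S ?R"
      by (intro word_cong.base) (auto simp: free_product_rels_def)
    ultimately show ?thesis using 1 by (intro bexI[of _ "Inl (inv\<^bsub>A\<^esub> a)"]) (auto intro: word_cong.trans)
  next
    case (2 b)
    then have "([Inr (inv\<^bsub>B\<^esub> b), Inr b], [Inr (inv\<^bsub>B\<^esub> b \<otimes>\<^bsub>B\<^esub> b)]) \<in> ?R"
      unfolding free_product_rels_def by (blast intro: B.inv_closed)
    with 2 have "([Inr (inv\<^bsub>B\<^esub> b), c], [Inr \<one>\<^bsub>B\<^esub>]) \<in> word_cong ?S ?R"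
      by (intro word_cong.base) auto
    moreover have "([Inr \<one>\<^bsub>B\<^esub>], []) \<in> word_cong ?S ?R"
      by (intro word_cong.base) (auto simp: free_product_rels_def)
    ultimately show ?thesis using 2 by (intro bexI[of _ "Inr (inv\<^bsub>B\<^esub> b)"]) (auto intro: word_cong.trans)
  qed
qed

lemma fp_inl_hom:
  assumes "monoid A"
  shows "fp_inl A B \<in> hom A (free_product A B)"
proof (rule homI)
  interpret monoid A by fact
  fix a a' assume a: "a \<in> carrier A" "a' \<in> carrier A"
  show "fp_inl A B a \<in> carrier (free_product A B)"
    using a by (auto simp: fp_inl_def free_product_def carrier_presented_monoid)
  have "([Inl a, Inl a'], [Inl (a \<otimes>\<^bsub>A\<^esub> a')]) \<in> free_product_rels A B"
    using a by (auto simp: free_product_rels_def)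
  with a show "fp_inl A B (a \<otimes>\<^bsub>A\<^esub> a') = fp_inl A B a \<otimes>\<^bsub>free_product A B\<^esub> fp_inl A B a'"
    unfolding fp_inl_def free_product_def
    by (subst mult_presented_monoid) (auto intro!: word_class_eqI[symmetric] word_cong.base)
qed

lemma fp_inr_hom:
  assumes "monoid B"
  shows "fp_inr A B \<in> hom B (free_product A B)"
proof (rule homI)
  interpret monoid B by fact
  fix b b' assume b: "b \<in> carrier B" "b' \<in> carrier B"
  show "fp_inr A B b \<in> carrier (free_product A B)"
    using b by (auto simp: fp_inr_def free_product_def carrier_presented_monoid)
  have "([Inr b, Inr b'], [Inr (b \<otimes>\<^bsub>B\<^esub> b')]) \<in> free_product_rels A B"
    using b by (auto simp: free_product_rels_def)
  with b show "fp_inr A B (b \<otimes>\<^bsub>B\<^esub> b') = fp_inr A B b \<otimes>\<^bsub>free_product A B\<^esub> fp_inr A B b'"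
    unfolding fp_inr_def free_product_def
    by (subst mult_presented_monoid) (auto intro!: word_class_eqI[symmetric] word_cong.base)
qed

lemma free_product_lift:
  assumes "group A" "group B" "group M" and j: "j \<in> hom A M" and k: "k \<in> hom B M"
  obtains \<theta> where "\<theta> \<in> hom (free_product A B) M"
    and "\<And>a. a \<in> carrier A \<Longrightarrow> \<theta> (fp_inl A B a) = j a"
    and "\<And>b. b \<in> carrier B \<Longrightarrow> \<theta> (fp_inr A B b) = k b"
proof -
  interpret A: group A by fact
  interpret B: group B by fact
  interpret M: group M by fact
  interpret j: group_hom A M j by unfold_locales (rule j)
  interpret k: group_hom B M k by unfold_locales (rule k)
  let ?S = "carrier A <+> carrier B" and ?R = "free_product_rels A B"
  let ?jk = "\<lambda>c. case c of Inl a \<Rightarrow> j a | Inr b \<Rightarrow> k b"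
  obtain \<theta> where hom: "\<theta> \<in> hom (free_product A B) M" and
    \<theta>: "\<And>u. u \<in> lists ?S \<Longrightarrow>
      \<theta> (word_class ?S ?R u) = foldr (\<lambda>c m. ?jk c \<otimes>\<^bsub>M\<^esub> m) u \<one>\<^bsub>M\<^esub>"
    unfolding free_product_def
    by (rule presented_monoid_lift[OF M.monoid_axioms, where A = ?S and R = ?R and j = ?jk])
       (auto simp: free_product_rels_def)
  show ?thesis
  proof (rule that[OF hom])
    show "\<theta> (fp_inl A B a) = j a" if "a \<in> carrier A" for a
      unfolding fp_inl_def using that by (subst \<theta>) auto
    show "\<theta> (fp_inr A B b) = k b" if "b \<in> carrier B" for b
      unfolding fp_inr_def using that by (subst \<theta>) auto
  qed
qed

definition normal_closure :: "('a, 'm) monoid_scheme \<Rightarrow> 'a set \<Rightarrow> 'a set" where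
  "normal_closure K S = \<Inter>{N. N \<lhd> K \<and> S \<subseteq> N}"

section \<open>Double cosets\<close>

definition double_coset :: "('g, 'm) monoid_scheme \<Rightarrow> 'g set \<Rightarrow> 'g \<Rightarrow> 'g set \<Rightarrow> 'g set" where
  "double_coset G A g B = A <#>\<^bsub>G\<^esub> (g <#\<^bsub>G\<^esub> B)"

definition double_cosets :: "('g, 'm) monoid_scheme \<Rightarrow> 'g set \<Rightarrow> 'g set set" where
  "double_cosets G H = (\<lambda>g. double_coset G H g H) ` carrier G"

definition dc_bar :: "('g, 'm) monoid_scheme \<Rightarrow> 'g set \<Rightarrow> 'g set \<Rightarrow> 'g set" where
  "dc_bar G H f =
    (THE f'. \<exists>g\<in>carrier G. f = double_coset G H g H \<and> f' = double_coset G H (inv\<^bsub>G\<^esub> g) H)"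

lemma dc_bar_double_coset:
  assumes "group G" "subgroup H G" "g \<in> carrier G"
  shows "dc_bar G H (double_coset G H g H) = double_coset G H (inv\<^bsub>G\<^esub> g) H"
proof -
  interpret group G by fact
  interpret H: subgroup H G by fact
  have *: "double_coset G H (inv\<^bsub>G\<^esub> x) H = set_inv\<^bsub>G\<^esub> (double_coset G H x H)"
    if x: "x \<in> carrier G" for x
  proof (intro subset_antisym subsetI)
    fix y assume "y \<in> double_coset G H (inv\<^bsub>G\<^esub> x) H"
    then obtain a b where "a \<in> H" "b \<in> H" "y = a \<otimes>\<^bsub>G\<^esub> (inv\<^bsub>G\<^esub> x \<otimes>\<^bsub>G\<^esub> b)"
      by (auto simp: double_coset_def set_mult_def l_coset_def)
    then have "y = inv\<^bsub>G\<^esub> (inv\<^bsub>G\<^esub> b \<otimes>\<^bsub>G\<^esub> (x \<otimes>\<^bsub>G\<^esub> inv\<^bsub>G\<^esub> a))" "inv\<^bsub>G\<^esub> a \<in> H" "inv\<^bsub>G\<^esub> b \<in> H"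
      using x by (auto simp: inv_mult_group m_assoc)
    then show "y \<in> set_inv\<^bsub>G\<^esub> (double_coset G H x H)"
      unfolding double_coset_def set_mult_def l_coset_def SET_INV_def by blast
  next
    fix y assume "y \<in> set_inv\<^bsub>G\<^esub> (double_coset G H x H)"
    then obtain a b where "a \<in> H" "b \<in> H" "y = inv\<^bsub>G\<^esub> (a \<otimes>\<^bsub>G\<^esub> (x \<otimes>\<^bsub>G\<^esub> b))"
      by (auto simp: double_coset_def set_mult_def l_coset_def SET_INV_def)
    then have "y = inv\<^bsub>G\<^esub> b \<otimes>\<^bsub>G\<^esub> (inv\<^bsub>G\<^esub> x \<otimes>\<^bsub>G\<^esub> inv\<^bsub>G\<^esub> a)" "inv\<^bsub>G\<^esub> a \<in> H" "inv\<^bsub>G\<^esub> b \<in> H"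
      using x by (auto simp: inv_mult_group m_assoc)
    then show "y \<in> double_coset G H (inv\<^bsub>G\<^esub> x) H"
      unfolding double_coset_def set_mult_def l_coset_def by blast
  qed
  show ?thesis
    unfolding dc_bar_def by (rule the_equality) (use assms(3) * in auto)
qed

definition is_section :: "('g, 'm) monoid_scheme \<Rightarrow> 'g set \<Rightarrow> ('g set \<Rightarrow> 'g) \<Rightarrow> bool" where
  "is_section G H \<sigma> \<longleftrightarrow>
    (\<forall>f\<in>double_cosets G H. \<sigma> f \<in> carrier G \<and> double_coset G H (\<sigma> f) H = f) \<and>
    \<sigma> H = \<one>\<^bsub>G\<^esub> \<and>
    (\<forall>f\<in>double_cosets G H.
      (dc_bar G H f \<noteq> f \<longrightarrow> \<sigma> (dc_bar G H f) = inv\<^bsub>G\<^esub> (\<sigma> f)) \<and>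
      (dc_bar G H f = f \<longrightarrow> \<sigma> f [^]\<^bsub>G\<^esub> (2::nat) \<in> H))"

definition dc_stab :: "('g, 'm) monoid_scheme \<Rightarrow> 'g set \<Rightarrow> ('g set \<Rightarrow> 'g) \<Rightarrow> 'g set \<Rightarrow> 'g set" where
  "dc_stab G H \<sigma> f = H \<inter> (\<sigma> f <#\<^bsub>G\<^esub> H #>\<^bsub>G\<^esub> inv\<^bsub>G\<^esub> (\<sigma> f))"

definition dc_iota :: "('g, 'm) monoid_scheme \<Rightarrow> ('g set \<Rightarrow> 'g) \<Rightarrow> 'g set \<Rightarrow> 'g \<Rightarrow> 'g" where
  "dc_iota G \<sigma> f h = inv\<^bsub>G\<^esub> (\<sigma> f) \<otimes>\<^bsub>G\<^esub> h \<otimes>\<^bsub>G\<^esub> \<sigma> f"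

definition is_transversals ::
    "('g, 'm) monoid_scheme \<Rightarrow> 'g set \<Rightarrow> ('g set \<Rightarrow> 'g) \<Rightarrow> ('g set \<Rightarrow> 'g set) \<Rightarrow> bool" where
  "is_transversals G H \<sigma> P \<longleftrightarrow>
    (\<forall>f\<in>double_cosets G H. P f \<subseteq> H \<and> \<one>\<^bsub>G\<^esub> \<in> P f \<and>
      (\<forall>h\<in>H. \<exists>!p. p \<in> P f \<and> p <#\<^bsub>G\<^esub> dc_stab G H \<sigma> f = h <#\<^bsub>G\<^esub> dc_stab G H \<sigma> f))"

definition is_double_transversals ::
    "('g, 'm) monoid_scheme \<Rightarrow> 'g set \<Rightarrow> ('g set \<Rightarrow> 'g) \<Rightarrow> ('g set \<Rightarrow> 'g set \<Rightarrow> 'g set) \<Rightarrow> bool" where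
  "is_double_transversals G H \<sigma> Q \<longleftrightarrow>
    (\<forall>f\<in>double_cosets G H. \<forall>f'\<in>double_cosets G H.
      Q f f' \<subseteq> H \<and> \<one>\<^bsub>G\<^esub> \<in> Q f f' \<and>
      (\<forall>h\<in>H. \<exists>!q. q \<in> Q f f' \<and>
        double_coset G (dc_stab G H \<sigma> f) q (dc_stab G H \<sigma> f') =
        double_coset G (dc_stab G H \<sigma> f) h (dc_stab G H \<sigma> f')) \<and>
      (f \<noteq> f' \<longrightarrow> Q f' f = set_inv\<^bsub>G\<^esub> (Q f f')))"

definition is_orientation :: "('g, 'm) monoid_scheme \<Rightarrow> 'g set \<Rightarrow> 'g set set \<Rightarrow> bool" where
  "is_orientation G H Ep \<longleftrightarrow>
    Ep \<subseteq> double_cosets G H \<and>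
    double_cosets G H = Ep \<union> {dc_bar G H f | f. f \<in> Ep \<and> f \<noteq> dc_bar G H f} \<and>
    Ep \<inter> {dc_bar G H f | f. f \<in> Ep \<and> f \<noteq> dc_bar G H f} = {}"

text \<open>The normal form \<open>g = \<rho>\<^sub>g \<sigma>(C(g)) \<lambda>\<^sub>g\<close>.\<close>

definition nf_rho ::
    "('g, 'm) monoid_scheme \<Rightarrow> 'g set \<Rightarrow> ('g set \<Rightarrow> 'g) \<Rightarrow> ('g set \<Rightarrow> 'g set) \<Rightarrow> 'g \<Rightarrow> 'g" where
  "nf_rho G H \<sigma> P g = (THE \<rho>. \<rho> \<in> P (double_coset G H g H) \<and>
    (\<exists>l\<in>H. g = \<rho> \<otimes>\<^bsub>G\<^esub> \<sigma> (double_coset G H g H) \<otimes>\<^bsub>G\<^esub> l))"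

definition nf_lambda ::
    "('g, 'm) monoid_scheme \<Rightarrow> 'g set \<Rightarrow> ('g set \<Rightarrow> 'g) \<Rightarrow> ('g set \<Rightarrow> 'g set) \<Rightarrow> 'g \<Rightarrow> 'g" where
  "nf_lambda G H \<sigma> P g = (THE l. l \<in> H \<and>
    (\<exists>\<rho>\<in>P (double_coset G H g H). g = \<rho> \<otimes>\<^bsub>G\<^esub> \<sigma> (double_coset G H g H) \<otimes>\<^bsub>G\<^esub> l))"

section \<open>The group \<open>H * F\<close> and the relators\<close>

text \<open>The base double coset \<open>e = C(1)\<close> is \<open>H\<close> itself, so the basis of \<open>F\<close> is indexed by \<open>Ep - {H}\<close>.\<close>

abbreviation HF_free :: "'g set \<Rightarrow> 'g set set \<Rightarrow> ('g set \<times> bool) list set monoid" where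
  "HF_free H Ep \<equiv> free_group (Ep - {H})"

definition HF :: "('g, 'm) monoid_scheme \<Rightarrow> 'g set \<Rightarrow> 'g set set \<Rightarrow>
    ('g + ('g set \<times> bool) list set) list set monoid" where
  "HF G H Ep = free_product (G\<lparr>carrier := H\<rparr>) (HF_free H Ep)"

definition HF_H :: "('g, 'm) monoid_scheme \<Rightarrow> 'g set \<Rightarrow> 'g set set \<Rightarrow> 'g \<Rightarrow>
    ('g + ('g set \<times> bool) list set) list set" where
  "HF_H G H Ep h = fp_inl (G\<lparr>carrier := H\<rparr>) (HF_free H Ep) h"

definition HF_x :: "('g, 'm) monoid_scheme \<Rightarrow> 'g set \<Rightarrow> 'g set set \<Rightarrow> 'g set \<Rightarrow>
    ('g + ('g set \<times> bool) list set) list set" where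
  "HF_x G H Ep f = fp_inr (G\<lparr>carrier := H\<rparr>) (HF_free H Ep)
    (if f = H then \<one>\<^bsub>HF_free H Ep\<^esub>
     else if f \<in> Ep then free_gen (Ep - {H}) f
     else inv\<^bsub>HF_free H Ep\<^esub> (free_gen (Ep - {H}) (dc_bar G H f)))"

text \<open>A relation \<open>u = v\<close> is expressed by the relator \<open>u \<otimes> inv v\<close>.\<close>

definition relators_I ::
    "('g, 'm) monoid_scheme \<Rightarrow> 'g set \<Rightarrow> ('g set \<Rightarrow> 'g) \<Rightarrow> 'g set set \<Rightarrow>
     ('g + ('g set \<times> bool) list set) list set set" where
  "relators_I G H \<sigma> Ep =
    (let K = HF G H Ep; \<eta> = HF_H G H Ep; x = HF_x G H Ep in
      {(\<eta> h \<otimes>\<^bsub>K\<^esub> x f) \<otimes>\<^bsub>K\<^esub> inv\<^bsub>K\<^esub> (x f \<otimes>\<^bsub>K\<^esub> \<eta> (dc_iota G \<sigma> f h)) | f h.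
        f \<in> Ep - {H} \<and> h \<in> dc_stab G H \<sigma> f})"

definition relators_II ::
    "('g, 'm) monoid_scheme \<Rightarrow> 'g set \<Rightarrow> ('g set \<Rightarrow> 'g) \<Rightarrow> ('g set \<Rightarrow> 'g set) \<Rightarrow>
     ('g set \<Rightarrow> 'g set \<Rightarrow> 'g set) \<Rightarrow> 'g set set \<Rightarrow> ('g set \<times> 'g set) set \<Rightarrow>
     ('g + ('g set \<times> bool) list set) list set set" where
  "relators_II G H \<sigma> P Q Ep r =
    (let K = HF G H Ep; \<eta> = HF_H G H Ep; x = HF_x G H Ep in
      {(x f \<otimes>\<^bsub>K\<^esub> \<eta> h \<otimes>\<^bsub>K\<^esub> x f') \<otimes>\<^bsub>K\<^esub>
         inv\<^bsub>K\<^esub> (\<eta> (nf_rho G H \<sigma> P g) \<otimes>\<^bsub>K\<^esub> x (double_coset G H g H) \<otimes>\<^bsub>K\<^esub> \<eta> (nf_lambda G H \<sigma> P g)) | f f' h g.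
        f \<in> double_cosets G H - {H} \<and> f' \<in> double_cosets G H - {H} \<and>
        (dc_bar G H f, f') \<in> r \<and> h \<in> Q (dc_bar G H f) f' \<and>
        g = \<sigma> f \<otimes>\<^bsub>G\<^esub> h \<otimes>\<^bsub>G\<^esub> \<sigma> f'})"

definition is_presentation_hom ::
    "('g, 'm) monoid_scheme \<Rightarrow> 'g set \<Rightarrow> ('g set \<Rightarrow> 'g) \<Rightarrow> 'g set set \<Rightarrow>
     (('g + ('g set \<times> bool) list set) list set \<Rightarrow> 'g) \<Rightarrow> bool" where
  "is_presentation_hom G H \<sigma> Ep \<pi> \<longleftrightarrow>
    \<pi> \<in> hom (HF G H Ep) G \<and>
    (\<forall>h\<in>H. \<pi> (HF_H G H Ep h) = h) \<and>
    (\<forall>f\<in>Ep - {H}. \<pi> (HF_x G H Ep f) = \<sigma> f)"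

end

theory Submission
  imports Defs
begin

text \<open>Let \<open>L\<close> be the quotient of \<open>H * F\<close> by the normal closure of the relators. The elements
\<open>a x\<^sub>f b\<close> of \<open>L\<close> with \<open>a, b \<in> H\<close> and \<open>f \<in> E\<close> form a subgroup: by the type (I) relations the
product \<open>x\<^sub>f h x\<^sub>f\<^sub>'\<close> depends, up to factors from \<open>H\<close>, only on the double coset of \<open>h\<close>, so it is again of
this form by a type (II) relation, applied to the product itself or to its inverse. This subgroup
contains the generators, hence is all of \<open>L\<close>. An element \<open>a x\<^sub>f b\<close> mapped to \<open>1\<close> in \<open>G\<close> satisfies
\<open>a \<sigma>(f) b = 1\<close>, so \<open>f = e\<close> and \<open>a b = 1\<close>, and the element itself is trivial.\<close>

section \<open>Groups, free groups and free products\<close>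

lemma (in group) inv_mult_cancel_left:
  "x \<in> carrier G \<Longrightarrow> y \<in> carrier G \<Longrightarrow> inv x \<otimes> (x \<otimes> y) = y"
  "x \<in> carrier G \<Longrightarrow> y \<in> carrier G \<Longrightarrow> x \<otimes> (inv x \<otimes> y) = y"
  by (simp_all flip: m_assoc)

lemma (in group) normal_normal_closure:
  assumes "S \<subseteq> carrier G"
  shows "normal_closure G S \<lhd> G"
proof -
  \<comment> \<open>The whole group belongs to the family being intersected; an empty family would
    give \<open>UNIV\<close> instead of a subgroup.\<close>
  have "carrier G \<lhd> G" by (simp add: normal_inv_iff subgroup_self)
  then have ne: "{N. N \<lhd> G \<and> S \<subseteq> N} \<noteq> {}" using assms by blast
  have "subgroup (normal_closure G S) G"
    unfolding normal_closure_def
    by (rule subgroups_Inter[OF _ ne]) (auto intro: normal_imp_subgroup)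
  then show ?thesis
    unfolding normal_closure_def normal_inv_iff by blast
qed

lemma normal_closure_superset: "S \<subseteq> normal_closure K S"
  by (auto simp: normal_closure_def)

lemma normal_closure_least: "N \<lhd> K \<Longrightarrow> S \<subseteq> N \<Longrightarrow> normal_closure K S \<subseteq> N"
  by (auto simp: normal_closure_def)

lemma (in normal) rcos_eq_iff:
  assumes "x \<in> carrier G" "y \<in> carrier G"
  shows "H #> x = H #> y \<longleftrightarrow> x \<otimes> inv y \<in> H"
  using assms rcos_module[OF is_group assms(2,1)] repr_independence[OF _ assms(2) subgroup_axioms]
    rcos_self[OF assms(1) subgroup_axioms] by blast

lemma (in group_hom) subgroup_vimage:
  assumes "subgroup U H"
  shows "subgroup {x \<in> carrier G. h x \<in> U} G"
proof -
  interpret U: subgroup U H by fact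
  show ?thesis by (rule G.subgroupI) (auto intro: exI[of _ \<one>])
qed

text \<open>An induction principle: every class is a finite product of one-letter classes. A
  property of elements holds everywhere once it cuts out a subgroup containing the letters.\<close>

lemma presented_monoid_subgroup_eq:
  assumes U: "subgroup U (presented_monoid A R)"
    and gen: "\<And>a. a \<in> A \<Longrightarrow> word_class A R [a] \<in> U"
  shows "U = carrier (presented_monoid A R)"
proof
  show "U \<subseteq> carrier (presented_monoid A R)" by (rule subgroup.subset[OF U])
  have "word_class A R u \<in> U" if "u \<in> lists A" for u
    using that
  proof (induction u)
    case Nil
    then show ?case using subgroup.one_closed[OF U] by (simp add: one_presented_monoid)
  next
    case (Cons a u)
    then have "word_class A R ([a] @ u) =
        word_class A R [a] \<otimes>\<^bsub>presented_monoid A R\<^esub> word_class A R u"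
      by (intro mult_presented_monoid[symmetric]) auto
    with Cons show ?case using subgroup.m_closed[OF U] gen by simp
  qed
  then show "carrier (presented_monoid A R) \<subseteq> U"
    unfolding carrier_presented_monoid by blast
qed

lemma free_group_subgroup_eq:
  fixes X :: "'a set"
  assumes U: "subgroup U (free_group X)" and gen: "\<And>x. x \<in> X \<Longrightarrow> free_gen X x \<in> U"
  shows "U = carrier (free_group X)"
  unfolding free_group_def
proof (rule presented_monoid_subgroup_eq[OF U[unfolded free_group_def]])
  interpret group "free_group X" by (rule group_free_group)
  define R :: "(('a \<times> bool) list \<times> ('a \<times> bool) list) set"
    where "R = {([(x, b), (x, \<not> b)], []) | x b. x \<in> X}"
  define c where "c = word_class (X \<times> UNIV) R"
  have F: "free_group X = presented_monoid (X \<times> UNIV) R"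
    by (simp add: free_group_def R_def)
  have gen_c: "free_gen X x = c [(x, True)]" for x by (simp add: free_gen_def c_def R_def)
  fix a :: "'a \<times> bool" assume "a \<in> X \<times> UNIV"
  then obtain x b where a: "a = (x, b)" "x \<in> X" by auto
  \<comment> \<open>The letter \<open>(x, False)\<close> has no \<open>free_gen\<close> of its own.
    Cancellation against \<open>(x, True)\<close> makes its class the inverse of
    \<open>free_gen X x\<close>, and \<open>U\<close> is closed under inverses.\<close>
  have "c [(x, False)] \<in> U"
  proof -
    have w: "[(x, False)] \<in> lists (X \<times> UNIV)" "[(x, True)] \<in> lists (X \<times> UNIV)"
      using a(2) by auto
    have "([(x, False), (x, \<not> False)], []) \<in> R" unfolding R_def using a(2) by blast
    then have "([(x, False)] @ [(x, True)], []) \<in> word_cong (X \<times> UNIV) R"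
      using a(2) by (intro word_cong.base) auto
    then have "c [(x, False)] \<otimes>\<^bsub>free_group X\<^esub> c [(x, True)] = \<one>\<^bsub>free_group X\<^esub>"
      unfolding c_def F one_presented_monoid mult_presented_monoid[OF w] by (rule word_class_eqI)
    moreover have "c [(x, False)] \<in> carrier (free_group X)" "c [(x, True)] \<in> carrier (free_group X)"
      unfolding c_def F carrier_presented_monoid using w by blast+
    ultimately have "inv\<^bsub>free_group X\<^esub> (c [(x, True)]) = c [(x, False)]"
      by (intro inv_equality)
    then show ?thesis using gen[OF a(2)] subgroup.m_inv_closed[OF U] gen_c by metis
  qed
  moreover have "c [(x, True)] \<in> U" using gen[OF a(2)] gen_c by metis
  ultimately have "c [a] \<in> U" unfolding a(1) by (cases b) auto
  then show "word_class (X \<times> UNIV) {([(x, b), (x, \<not> b)], []) | x b. x \<in> X} [a] \<in> U"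
    by (simp only: c_def R_def)
qed

lemma free_product_subgroup_eq:
  assumes U: "subgroup U (free_product A B)"
    and "\<And>a. a \<in> carrier A \<Longrightarrow> fp_inl A B a \<in> U"
    and "\<And>b. b \<in> carrier B \<Longrightarrow> fp_inr A B b \<in> U"
  shows "U = carrier (free_product A B)"
  unfolding free_product_def
  by (rule presented_monoid_subgroup_eq[OF U[unfolded free_product_def]])
    (use assms in \<open>auto simp: fp_inl_def fp_inr_def\<close>)

lemma free_gen_closed: "x \<in> X \<Longrightarrow> free_gen X x \<in> carrier (free_group X)"
  by (auto simp: free_gen_def free_group_def carrier_presented_monoid)

section \<open>Double cosets\<close>

lemma mem_double_coset:
  "z \<in> double_coset G A g B \<longleftrightarrow> (\<exists>a\<in>A. \<exists>b\<in>B. z = a \<otimes>\<^bsub>G\<^esub> (g \<otimes>\<^bsub>G\<^esub> b))"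
  by (auto simp: double_coset_def set_mult_def l_coset_def)

locale double_coset_section = group G + H: subgroup H G
  for G (structure) and H +
  fixes \<sigma>
  assumes sigma: "is_section G H \<sigma>"
begin

abbreviation "C g \<equiv> double_coset G H g H"
abbreviation "E \<equiv> double_cosets G H"
abbreviation "bar \<equiv> dc_bar G H"
abbreviation "stab \<equiv> dc_stab G H \<sigma>"
abbreviation "iota \<equiv> dc_iota G \<sigma>"

lemma mem_C:
  assumes "g \<in> carrier G"
  shows "x \<in> C g \<longleftrightarrow> (\<exists>a\<in>H. \<exists>b\<in>H. x = a \<otimes> g \<otimes> b)"
  using assms by (simp add: mem_double_coset m_assoc cong: bex_cong)

lemma C_eq:
  assumes g: "g \<in> carrier G" and a: "a \<in> H" and b: "b \<in> H"
  shows "C (a \<otimes> g \<otimes> b) = C g"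
proof -
  have sub: "C (c \<otimes> x \<otimes> d) \<subseteq> C x" if x: "x \<in> carrier G" "c \<in> H" "d \<in> H" for x c d
  proof
    fix z assume "z \<in> C (c \<otimes> x \<otimes> d)"
    then obtain a' b' where "a' \<in> H" "b' \<in> H" "z = a' \<otimes> (c \<otimes> x \<otimes> d) \<otimes> b'"
      using x by (auto simp: mem_C)
    then have "z = (a' \<otimes> c) \<otimes> x \<otimes> (d \<otimes> b')" "a' \<otimes> c \<in> H" "d \<otimes> b' \<in> H"
      using x by (auto simp: m_assoc)
    then show "z \<in> C x" using x by (auto simp: mem_C)
  qed
  \<comment> \<open>Since \<open>g\<close> is in turn a two-sided translate of
    \<open>a \<otimes> g \<otimes> b\<close> by elements of \<open>H\<close>, the inclusion
    \<open>sub\<close> also gives the converse.\<close>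
  have "g = inv a \<otimes> (a \<otimes> g \<otimes> b) \<otimes> inv b"
    using assms by (simp add: m_assoc inv_mult_cancel_left)
  then have "C g \<subseteq> C (a \<otimes> g \<otimes> b)" using sub[of "a \<otimes> g \<otimes> b" "inv a" "inv b"] assms by simp
  then show ?thesis using sub[OF assms] by blast
qed

lemma C_H: "h \<in> H \<Longrightarrow> C h = H"
proof -
  assume h: "h \<in> H"
  have "C \<one> = H"
  proof (rule Set.set_eqI)
    fix x
    have "x = x \<otimes> \<one> \<otimes> \<one>" if "x \<in> H" using that by simp
    then show "x \<in> C \<one> \<longleftrightarrow> x \<in> H"
      unfolding mem_C[OF one_closed] using H.one_closed H.m_closed by (metis H.mem_carrier r_one)
  qed
  then show ?thesis using C_eq[of \<one> h \<one>] h by simp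
qed

lemma H_in_E: "H \<in> E"
  using C_H[OF H.one_closed] by (auto simp: double_cosets_def)

lemma C_in_E: "g \<in> carrier G \<Longrightarrow> C g \<in> E"
  by (simp add: double_cosets_def)

lemma section_closed [simp]: "f \<in> E \<Longrightarrow> \<sigma> f \<in> carrier G"
  and C_section: "f \<in> E \<Longrightarrow> C (\<sigma> f) = f"
  and section_H: "\<sigma> H = \<one>"
  and section_bar: "f \<in> E \<Longrightarrow> bar f \<noteq> f \<Longrightarrow> \<sigma> (bar f) = inv (\<sigma> f)"
  and section_square: "f \<in> E \<Longrightarrow> bar f = f \<Longrightarrow> \<sigma> f \<otimes> \<sigma> f \<in> H"
  using sigma by (auto simp: is_section_def numeral_2_eq_2)

text \<open>\<open>g\<close> lies in its own double coset, which is also that of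
  \<open>\<sigma> (C g)\<close>. The left factor may be any element of \<open>H\<close>, a looser
  form than the normal form, and this is what surjectivity uses.\<close>

lemma decomposition:
  assumes "g \<in> carrier G"
  obtains a b where "a \<in> H" "b \<in> H" "g = a \<otimes> \<sigma> (C g) \<otimes> b"
proof -
  have "g \<in> C g"
    unfolding mem_C[OF assms] using assms by (intro bexI[of _ \<one>]) auto
  then have "g \<in> C (\<sigma> (C g))" using assms by (simp add: C_section C_in_E)
  then show ?thesis using that assms by (auto simp: mem_C C_in_E)
qed

lemma bar_C: "g \<in> carrier G \<Longrightarrow> bar (C g) = C (inv g)"
  by (rule dc_bar_double_coset[OF is_group H.subgroup_axioms])

lemma bar_in_E: "f \<in> E \<Longrightarrow> bar f \<in> E"
  by (metis C_in_E C_section bar_C inv_closed section_closed)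

lemma bar_bar: "f \<in> E \<Longrightarrow> bar (bar f) = f"
  by (metis C_section bar_C inv_closed inv_inv section_closed)

lemma bar_H: "bar H = H"
  using bar_C[of \<one>] by (simp add: C_H)

lemma bar_eq_H_iff: "f \<in> E \<Longrightarrow> bar f = H \<longleftrightarrow> f = H"
  using bar_H bar_bar by metis

text \<open>Replaces the conjugate of \<open>H\<close> in the definition by a condition on
  \<open>iota\<close>, the form in which elements are later moved across \<sigma>(f) and
  x_f.\<close>

lemma mem_stab:
  assumes "f \<in> E"
  shows "h \<in> stab f \<longleftrightarrow> h \<in> H \<and> iota f h \<in> H"
proof -
  have "h \<in> \<sigma> f <# H #> inv (\<sigma> f) \<longleftrightarrow> iota f h \<in> H" if h: "h \<in> H"
  proof
    assume "h \<in> \<sigma> f <# H #> inv (\<sigma> f)"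
    then obtain k where "k \<in> H" "h = \<sigma> f \<otimes> k \<otimes> inv (\<sigma> f)"
      by (auto simp: l_coset_def r_coset_def)
    then show "iota f h \<in> H"
      using assms by (simp add: dc_iota_def m_assoc inv_mult_cancel_left)
  next
    assume "iota f h \<in> H"
    moreover have "h = \<sigma> f \<otimes> iota f h \<otimes> inv (\<sigma> f)"
      using assms h by (simp add: dc_iota_def m_assoc inv_mult_cancel_left)
    ultimately show "h \<in> \<sigma> f <# H #> inv (\<sigma> f)"
      by (auto simp: l_coset_def r_coset_def)
  qed
  then show ?thesis by (auto simp: dc_stab_def)
qed

lemma iota_mult:
  "f \<in> E \<Longrightarrow> h \<in> carrier G \<Longrightarrow> k \<in> carrier G \<Longrightarrow> iota f (h \<otimes> k) = iota f h \<otimes> iota f k"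
  by (simp add: dc_iota_def m_assoc inv_mult_cancel_left)

lemma subgroup_stab:
  assumes f: "f \<in> E"
  shows "subgroup (stab f) G"
proof (rule subgroupI)
  show "stab f \<subseteq> carrier G" by (auto simp: dc_stab_def)
  have "\<one> \<in> stab f" using f by (simp add: mem_stab) (simp add: dc_iota_def)
  then show "stab f \<noteq> {}" by blast
next
  fix h assume h: "h \<in> stab f"
  then have "iota f (inv h) = inv (iota f h)"
    using f by (simp add: mem_stab) (simp add: dc_iota_def inv_mult_group m_assoc)
  then show "inv h \<in> stab f" using h f by (simp add: mem_stab)
next
  fix h k assume "h \<in> stab f" "k \<in> stab f"
  then show "h \<otimes> k \<in> stab f" using f by (simp add: mem_stab iota_mult)
qed

text \<open>The preimage of \<open>k\<close> must be \<sigma>(f) k \<sigma>(f)^-1; the point is that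
  it lies in \<open>H\<close>. If \<open>bar f\<close> differs from \<open>f\<close>, it equals
  \<open>iota (bar f) k\<close>. If \<open>f\<close> is self-inverse, put s = \<sigma>(f)^2, an
  element of \<open>H\<close>: conjugating \<open>iota f k\<close> by s gives the same
  element.\<close>

lemma iota_surj:
  assumes f: "f \<in> E" and k: "k \<in> stab (bar f)"
  obtains h where "h \<in> stab f" "iota f h = k"
proof -
  let ?h = "\<sigma> f \<otimes> k \<otimes> inv (\<sigma> f)"
  have kH: "k \<in> H" and ik: "iota (bar f) k \<in> H"
    using k f by (simp_all add: mem_stab bar_in_E)
  have "iota f ?h = k"
    using f kH by (simp add: dc_iota_def m_assoc inv_mult_cancel_left)
  moreover have "?h \<in> H"
  proof (cases "bar f = f")
    case False
    then show ?thesis using ik f by (simp add: dc_iota_def section_bar)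
  next
    case True
    let ?s = "\<sigma> f \<otimes> \<sigma> f"
    have "?s \<otimes> iota f k \<otimes> inv ?s \<in> H"
      using section_square[OF f True] ik by (simp add: True)
    also have "?s \<otimes> iota f k \<otimes> inv ?s = ?h"
      using f kH by (simp add: dc_iota_def m_assoc inv_mult_group inv_mult_cancel_left)
    finally show ?thesis .
  qed
  ultimately show ?thesis using that f kH by (simp add: mem_stab)
qed

text \<open>Write g = a \<sigma>(f) b and a = p k with p in \<open>P f\<close> and k in H_f; then k
  crosses \<sigma>(f) and joins the right factor as \<open>iota f k\<close>. As
  \<open>nf_rho\<close> and \<open>nf_lambda\<close> are definite descriptions, uniqueness has to be
  proved along with existence.\<close>

lemma normal_form:
  assumes P: "is_transversals G H \<sigma> P" and g: "g \<in> carrier G"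
  shows "nf_rho G H \<sigma> P g \<in> H" "nf_lambda G H \<sigma> P g \<in> H"
    "g = nf_rho G H \<sigma> P g \<otimes> \<sigma> (C g) \<otimes> nf_lambda G H \<sigma> P g"
proof -
  let ?f = "C g"
  have f: "?f \<in> E" by (rule C_in_E[OF g])
  note S = subgroup_stab[OF f]
  have PH: "P ?f \<subseteq> H" using P f by (auto simp: is_transversals_def)
  have P1: "\<exists>!p. p \<in> P ?f \<and> p <# stab ?f = h <# stab ?f" if "h \<in> H" for h
    using P f that by (auto simp: is_transversals_def)
  obtain a b where ab: "a \<in> H" "b \<in> H" "g = a \<otimes> \<sigma> ?f \<otimes> b"
    using decomposition[OF g] .
  obtain p where p: "p \<in> P ?f" "p <# stab ?f = a <# stab ?f" using P1[OF ab(1)] by blast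
  have "a \<in> a <# stab ?f"
    using subgroup.one_closed[OF S] ab(1) by (force simp: l_coset_def)
  then obtain k where k: "k \<in> stab ?f" "a = p \<otimes> k"
    using p(2) by (auto simp: l_coset_def)
  have kH: "k \<in> H" "iota ?f k \<in> H" and pH: "p \<in> H" using k f p PH by (auto simp: mem_stab)
  let ?l = "iota ?f k \<otimes> b"
  have l: "?l \<in> H" using kH ab by simp
  have g_eq: "g = p \<otimes> \<sigma> ?f \<otimes> ?l"
    by (subst ab(3)) (use f kH pH k ab(2) in
      \<open>simp add: dc_iota_def m_assoc inv_mult_cancel_left\<close>)
  \<comment> \<open>Comparing two forms expresses \<open>iota\<close> of p^-1 p' through elements of
    \<open>H\<close>, so p^-1 p' lies in H_f. Then p and p' represent the same left coset and agree,
    and cancellation identifies the right factors.\<close>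
  have uniq: "p' = p \<and> l' = ?l"
    if that: "p' \<in> P ?f" "l' \<in> H" "g = p' \<otimes> \<sigma> ?f \<otimes> l'" for p' l'
  proof -
    have p'H: "p' \<in> H" using that PH by blast
    have eq: "p' \<otimes> \<sigma> ?f \<otimes> l' = p \<otimes> \<sigma> ?f \<otimes> ?l" using that(3) g_eq by simp
    then have "p' \<otimes> \<sigma> ?f = p \<otimes> \<sigma> ?f \<otimes> ?l \<otimes> inv l'"
      using f p'H pH l that(2) by (metis inv_solve_right H.mem_carrier m_closed section_closed)
    then have "iota ?f (inv p \<otimes> p') = ?l \<otimes> inv l'"
      using f p'H pH l that(2) by (simp add: dc_iota_def m_assoc inv_mult_cancel_left)
    then have "inv p \<otimes> p' \<in> stab ?f"
      using f p'H pH l that(2) by (simp add: mem_stab)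
    moreover have "p' = p \<otimes> (inv p \<otimes> p')" using pH p'H by (simp add: inv_mult_cancel_left)
    ultimately have "p' \<in> p <# stab ?f" by (auto simp: l_coset_def)
    then have "p <# stab ?f = p' <# stab ?f" using l_repr_independence[OF _ _ S] pH by simp
    then have "p' = p" using P1[OF pH] p(1) that(1) by metis
    with eq show ?thesis using f pH l that(2) by (simp add: m_assoc)
  qed
  have "nf_rho G H \<sigma> P g = p"
    unfolding nf_rho_def by (rule the_equality) (use p(1) l g_eq uniq in blast)+
  moreover have "nf_lambda G H \<sigma> P g = ?l"
    unfolding nf_lambda_def by (rule the_equality) (use p(1) l g_eq uniq in blast)+
  ultimately show "nf_rho G H \<sigma> P g \<in> H" "nf_lambda G H \<sigma> P g \<in> H"
    "g = nf_rho G H \<sigma> P g \<otimes> \<sigma> (C g) \<otimes> nf_lambda G H \<sigma> P g"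
    using pH l g_eq by simp_all
qed

lemma double_transversals_subset:
  "is_double_transversals G H \<sigma> Q \<Longrightarrow> f \<in> E \<Longrightarrow> f' \<in> E \<Longrightarrow> Q f f' \<subseteq> H"
  unfolding is_double_transversals_def by meson

section \<open>Orientations of the set of double cosets\<close>

lemma orientation_subset: "is_orientation G H Ep \<Longrightarrow> Ep \<subseteq> E"
  by (simp add: is_orientation_def)

text \<open>With \<open>notin_orientation\<close> this leaves exactly one of \<open>f\<close> and
  \<open>bar f\<close> in \<open>Ep\<close> whenever they differ, which decides the branch taken in
  \<open>HF_x\<close>.\<close>

lemma bar_notin_orientation:
  assumes Ep: "is_orientation G H Ep" and f: "f \<in> Ep" "bar f \<noteq> f"
  shows "bar f \<notin> Ep"
proof
  let ?D = "{bar f | f. f \<in> Ep \<and> f \<noteq> bar f}"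
  assume "bar f \<in> Ep"
  moreover have "bar f \<in> ?D"
    by (rule CollectI, rule exI[of _ f]) (use f in simp)
  ultimately have "bar f \<in> Ep \<inter> ?D" by (rule IntI)
  moreover have "Ep \<inter> ?D = {}" using Ep unfolding is_orientation_def by (elim conjE)
  ultimately show False by (simp only: empty_iff)
qed

lemma notin_orientation:
  assumes Ep: "is_orientation G H Ep" and f: "f \<in> E" "f \<notin> Ep"
  shows "bar f \<in> Ep" "bar f \<noteq> f"
proof -
  let ?D = "{bar f | f. f \<in> Ep \<and> f \<noteq> bar f}"
  have "E = Ep \<union> ?D" using Ep unfolding is_orientation_def by (elim conjE)
  then have "f \<in> Ep \<union> ?D" by (rule subst) (rule f(1))
  then have "f \<in> ?D" by (rule UnE) (rule notE[OF f(2)])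
  then obtain f' where f': "f = bar f'" "f' \<in> Ep" "f' \<noteq> bar f'" by (elim CollectE exE conjE)
  then have "bar f = f'" using bar_bar[OF subsetD[OF orientation_subset[OF Ep] f'(2)]] by simp
  then show "bar f \<in> Ep" "bar f \<noteq> f" using f' by simp_all
qed

end

section \<open>Normal forms in a group satisfying the relations\<close>

text \<open>\<open>L\<close> is kept abstract so that the rewriting is free of coset notation; it
  becomes the quotient of H * F by a normal subgroup containing the relators. \<open>x_bar\<close>
  is demanded only where \<open>bar f\<close> differs from \<open>f\<close>; the inverse of
  \<open>x f\<close> for self-inverse \<open>f\<close> is computed in \<open>inv_x\<close>.\<close>

locale double_coset_relations = double_coset_section G H \<sigma> + L: group L
  for G (structure) and H and \<sigma> and L (structure) +
  fixes P Q Ep r \<eta> x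
  assumes P: "is_transversals G H \<sigma> P"
    and Q: "is_double_transversals G H \<sigma> Q"
    and orientation: "is_orientation G H Ep"
    and order: "linear_order_on (E - {H}) r"
    and \<eta>_hom: "\<eta> \<in> hom (G\<lparr>carrier := H\<rparr>) L"
    and x_closed [simp]: "f \<in> E \<Longrightarrow> x f \<in> carrier L"
    and x_H: "x H = \<one>\<^bsub>L\<^esub>"
    and x_bar: "f \<in> E \<Longrightarrow> bar f \<noteq> f \<Longrightarrow> x (bar f) = inv\<^bsub>L\<^esub> (x f)"
    and relation_I: "f \<in> Ep - {H} \<Longrightarrow> h \<in> stab f \<Longrightarrow>
      \<eta> h \<otimes>\<^bsub>L\<^esub> x f = x f \<otimes>\<^bsub>L\<^esub> \<eta> (iota f h)"
    and relation_II: "f \<in> E - {H} \<Longrightarrow> f' \<in> E - {H} \<Longrightarrow> (bar f, f') \<in> r \<Longrightarrow>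
      h \<in> Q (bar f) f' \<Longrightarrow> g = \<sigma> f \<otimes>\<^bsub>G\<^esub> h \<otimes>\<^bsub>G\<^esub> \<sigma> f' \<Longrightarrow>
      x f \<otimes>\<^bsub>L\<^esub> \<eta> h \<otimes>\<^bsub>L\<^esub> x f' =
        \<eta> (nf_rho G H \<sigma> P g) \<otimes>\<^bsub>L\<^esub> x (C g) \<otimes>\<^bsub>L\<^esub> \<eta> (nf_lambda G H \<sigma> P g)"
begin

interpretation \<eta>: group_hom "G\<lparr>carrier := H\<rparr>" L \<eta>
  by (rule group_hom.intro[OF H.subgroup_is_group[OF is_group] L.is_group])
    (simp add: group_hom_axioms_def \<eta>_hom)

lemma \<eta>_closed [simp]: "h \<in> H \<Longrightarrow> \<eta> h \<in> carrier L"
  using \<eta>.hom_closed by simp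

lemma \<eta>_mult: "h \<in> H \<Longrightarrow> k \<in> H \<Longrightarrow> \<eta> (h \<otimes>\<^bsub>G\<^esub> k) = \<eta> h \<otimes>\<^bsub>L\<^esub> \<eta> k"
  using \<eta>.hom_mult by simp

lemma \<eta>_one: "\<eta> \<one>\<^bsub>G\<^esub> = \<one>\<^bsub>L\<^esub>"
  using \<eta>.hom_one by simp

lemma \<eta>_inv: "h \<in> H \<Longrightarrow> \<eta> (inv\<^bsub>G\<^esub> h) = inv\<^bsub>L\<^esub> \<eta> h"
  using \<eta>.hom_inv[of h] m_inv_consistent[OF H.subgroup_axioms] by simp

text \<open>For \<open>f\<close> = \<open>H\<close> both \<sigma>(f) and \<open>x f\<close> are
  trivial. For \<open>f\<close> outside \<open>Ep\<close>, take the type (I) relation of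
  \<open>bar f\<close> at the preimage \<open>k\<close> of \<open>h\<close> under its
  \<open>iota\<close> and multiply by the inverse of \<open>x (bar f)\<close> on both sides.\<close>

lemma relation_I_all:
  assumes f: "f \<in> E" and h: "h \<in> stab f"
  shows "\<eta> h \<otimes>\<^bsub>L\<^esub> x f = x f \<otimes>\<^bsub>L\<^esub> \<eta> (iota f h)"
proof (cases "f = H")
  case True
  have "h \<in> H" using h f by (simp add: mem_stab)
  then show ?thesis using True by (simp add: x_H dc_iota_def section_H)
next
  case fH: False
  show ?thesis
  proof (cases "f \<in> Ep")
    case True
    then show ?thesis using relation_I fH h by simp
  next
    case False
    define f\<^sub>0 where "f\<^sub>0 = bar f"
    have f0: "f\<^sub>0 \<in> Ep" "f\<^sub>0 \<in> E" "bar f\<^sub>0 \<noteq> f\<^sub>0" "f = bar f\<^sub>0"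
      using notin_orientation[OF orientation f False] bar_in_E[OF f] bar_bar[OF f]
      by (simp_all add: f\<^sub>0_def)
    obtain k where k: "k \<in> stab f\<^sub>0" "iota f\<^sub>0 k = h"
      using iota_surj[OF f0(2)] h f0(4) by blast
    have kH: "k \<in> H" "h \<in> H" using k(1) h f f0(2) by (simp_all add: mem_stab)
    have "f\<^sub>0 \<noteq> H" using f0(3) bar_H by metis
    then have rel: "\<eta> k \<otimes>\<^bsub>L\<^esub> x f\<^sub>0 = x f\<^sub>0 \<otimes>\<^bsub>L\<^esub> \<eta> h"
      using relation_I f0(1) k by simp
    have "iota f h = k"
      using f0 kH(1) unfolding f0(4) k(2)[symmetric]
      by (simp add: dc_iota_def section_bar m_assoc inv_mult_cancel_left)
    moreover have "x f = inv\<^bsub>L\<^esub> x f\<^sub>0" using f0 x_bar by simp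
    moreover have "\<eta> h \<otimes>\<^bsub>L\<^esub> inv\<^bsub>L\<^esub> x f\<^sub>0 = inv\<^bsub>L\<^esub> x f\<^sub>0 \<otimes>\<^bsub>L\<^esub> (x f\<^sub>0 \<otimes>\<^bsub>L\<^esub> \<eta> h) \<otimes>\<^bsub>L\<^esub> inv\<^bsub>L\<^esub> x f\<^sub>0"
      using kH f0(2) by (simp add: L.m_assoc L.inv_mult_cancel_left)
    moreover have "\<dots> = inv\<^bsub>L\<^esub> x f\<^sub>0 \<otimes>\<^bsub>L\<^esub> \<eta> k"
      unfolding rel[symmetric] using kH f0(2) by (simp add: L.m_assoc)
    ultimately show ?thesis by simp
  qed
qed

text \<open>The outer factors range over all of \<open>H\<close> and not over a transversal, so
  multiplication by \<open>H\<close> on either side visibly preserves the set.\<close>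

definition NF where
  "NF = {\<eta> a \<otimes>\<^bsub>L\<^esub> x f \<otimes>\<^bsub>L\<^esub> \<eta> b | a f b. a \<in> H \<and> f \<in> E \<and> b \<in> H}"

lemma NF_I: "a \<in> H \<Longrightarrow> f \<in> E \<Longrightarrow> b \<in> H \<Longrightarrow> \<eta> a \<otimes>\<^bsub>L\<^esub> x f \<otimes>\<^bsub>L\<^esub> \<eta> b \<in> NF"
  by (auto simp: NF_def)

lemma NF_E:
  assumes "u \<in> NF"
  obtains a f b where "a \<in> H" "f \<in> E" "b \<in> H" "u = \<eta> a \<otimes>\<^bsub>L\<^esub> x f \<otimes>\<^bsub>L\<^esub> \<eta> b"
  using assms by (auto simp: NF_def)

lemma NF_mult_\<eta>:
  assumes "u \<in> NF" "a \<in> H" "b \<in> H"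
  shows "\<eta> a \<otimes>\<^bsub>L\<^esub> u \<otimes>\<^bsub>L\<^esub> \<eta> b \<in> NF"
  using assms(1)
proof (rule NF_E)
  fix c f d assume c: "c \<in> H" "f \<in> E" "d \<in> H" "u = \<eta> c \<otimes>\<^bsub>L\<^esub> x f \<otimes>\<^bsub>L\<^esub> \<eta> d"
  then have "\<eta> a \<otimes>\<^bsub>L\<^esub> u \<otimes>\<^bsub>L\<^esub> \<eta> b = \<eta> (a \<otimes>\<^bsub>G\<^esub> c) \<otimes>\<^bsub>L\<^esub> x f \<otimes>\<^bsub>L\<^esub> \<eta> (d \<otimes>\<^bsub>G\<^esub> b)"
    using assms by (simp add: \<eta>_mult L.m_assoc)
  then show ?thesis using assms c NF_I by simp
qed

lemma NF_\<eta>: "h \<in> H \<Longrightarrow> \<eta> h \<in> NF"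
  using NF_I[of h H "\<one>\<^bsub>G\<^esub>"] by (simp add: H_in_E x_H \<eta>_one)

lemma NF_x: "f \<in> E \<Longrightarrow> x f \<in> NF"
  using NF_I[of "\<one>\<^bsub>G\<^esub>" f "\<one>\<^bsub>G\<^esub>"] by (simp add: \<eta>_one)

lemma NF_carrier: "NF \<subseteq> carrier L"
  by (auto simp: NF_def)

text \<open>Passes from representatives in \<open>Q\<close> to all of \<open>H\<close>. Write h = a
  q b with a in H_{bar f}, b in H_{f'} and q in \<open>Q (bar f) f'\<close>. By type (I), a leaves
  to the left across \<open>x f\<close>, as the \<open>c\<close> with \<open>iota f c = a\<close>,
  and b leaves to the right across \<open>x f'\<close>; a type (II) relation applies to what
  remains.\<close>

lemma relation_II_NF:
  assumes f: "f \<in> E - {H}" and f': "f' \<in> E - {H}" and le: "(bar f, f') \<in> r" and h: "h \<in> H"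
  shows "x f \<otimes>\<^bsub>L\<^esub> \<eta> h \<otimes>\<^bsub>L\<^esub> x f' \<in> NF"
proof -
  have fE: "f \<in> E" "bar f \<in> E" "f' \<in> E" using f f' bar_in_E by auto
  note S = subgroup_stab[OF fE(2)] subgroup_stab[OF fE(3)]
  obtain q where q: "q \<in> Q (bar f) f'" "q \<in> H"
    "double_coset G (stab (bar f)) q (stab f') = double_coset G (stab (bar f)) h (stab f')"
    using Q h fE unfolding is_double_transversals_def by (meson subsetD)
  have "h = \<one>\<^bsub>G\<^esub> \<otimes>\<^bsub>G\<^esub> (h \<otimes>\<^bsub>G\<^esub> \<one>\<^bsub>G\<^esub>)" using h by simp
  then have "h \<in> double_coset G (stab (bar f)) h (stab f')"
    using S[THEN subgroup.one_closed] mem_double_coset by metis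
  then obtain a b where ab: "a \<in> stab (bar f)" "b \<in> stab f'" "h = a \<otimes>\<^bsub>G\<^esub> (q \<otimes>\<^bsub>G\<^esub> b)"
    unfolding q(3)[symmetric] mem_double_coset by blast
  obtain c where c: "c \<in> stab f" "iota f c = a" using iota_surj[OF fE(1) ab(1)] .
  let ?d = "iota f' b" and ?g = "\<sigma> f \<otimes>\<^bsub>G\<^esub> q \<otimes>\<^bsub>G\<^esub> \<sigma> f'"
  have m: "a \<in> H" "b \<in> H" "c \<in> H" "?d \<in> H" using ab c fE by (auto simp: mem_stab)
  have ca: "\<eta> c \<otimes>\<^bsub>L\<^esub> x f = x f \<otimes>\<^bsub>L\<^esub> \<eta> a" using relation_I_all[OF fE(1) c(1)] c(2) by simp
  have bd: "\<eta> b \<otimes>\<^bsub>L\<^esub> x f' = x f' \<otimes>\<^bsub>L\<^esub> \<eta> ?d" using relation_I_all[OF fE(3) ab(2)] .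
  have g: "?g \<in> carrier G" using fE q(2) by simp
  have "x f \<otimes>\<^bsub>L\<^esub> \<eta> h \<otimes>\<^bsub>L\<^esub> x f' = (x f \<otimes>\<^bsub>L\<^esub> \<eta> a) \<otimes>\<^bsub>L\<^esub> \<eta> q \<otimes>\<^bsub>L\<^esub> (\<eta> b \<otimes>\<^bsub>L\<^esub> x f')"
    using fE m q(2) by (simp add: ab(3) \<eta>_mult L.m_assoc)
  also have "\<dots> = \<eta> c \<otimes>\<^bsub>L\<^esub> (x f \<otimes>\<^bsub>L\<^esub> \<eta> q \<otimes>\<^bsub>L\<^esub> x f') \<otimes>\<^bsub>L\<^esub> \<eta> ?d"
    unfolding ca[symmetric] bd using fE m q(2) by (simp add: L.m_assoc)
  finally show ?thesis
    unfolding relation_II[OF f f' le q(1) HOL.refl]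
    using normal_form[OF P g] NF_I NF_mult_\<eta> C_in_E[OF g] m by simp
qed

text \<open>\<open>total_on\<close> compares only distinct elements, so the diagonal comes from
  reflexivity; \<open>inv_x\<close> uses exactly that case.\<close>

lemma order_cases:
  assumes "f \<in> E - {H}" "f' \<in> E - {H}"
  shows "(f, f') \<in> r \<or> (f', f) \<in> r"
proof (cases "f = f'")
  case True
  have "refl_on (E - {H}) r"
    using order by (simp add: order_on_defs)
  then show ?thesis using True assms by (auto dest: refl_onD)
next
  case False
  then show ?thesis using order assms by (auto simp: order_on_defs total_on_def)
qed

text \<open>If \<open>f\<close> is self-inverse then \<open>x f \<otimes> x f \<in> \<eta> ` H\<close>, by the type (II) relation with \<open>h = 1\<close>.\<close>

lemma inv_x:
  assumes f: "f \<in> E"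
  obtains c where "c \<in> H" "inv\<^bsub>L\<^esub> x f = x (bar f) \<otimes>\<^bsub>L\<^esub> \<eta> c"
proof (cases "f = H \<or> bar f \<noteq> f")
  case True
  then have "inv\<^bsub>L\<^esub> x f = x (bar f)"
    using x_bar[OF f] by (metis L.inv_one bar_H x_H)
  moreover have "x (bar f) = x (bar f) \<otimes>\<^bsub>L\<^esub> \<eta> \<one>\<^bsub>G\<^esub>"
    unfolding \<eta>_one by (rule L.r_one[OF x_closed[OF bar_in_E[OF f]], symmetric])
  ultimately have "inv\<^bsub>L\<^esub> x f = x (bar f) \<otimes>\<^bsub>L\<^esub> \<eta> \<one>\<^bsub>G\<^esub>" by (rule HOL.trans)
  then show ?thesis by (rule that[OF H.one_closed])
next
  case False
  then have fE: "f \<in> E - {H}" and bar: "bar f = f" using f by simp_all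
  \<comment> \<open>By \<open>section_square\<close> this element lies in \<open>H\<close>, so
    \<open>C ?g = H\<close> and the middle factor \<open>x (C ?g)\<close> of the type (II) relation
    is trivial: its right side lies in the image of \<eta>.\<close>
  let ?g = "\<sigma> f \<otimes>\<^bsub>G\<^esub> \<one>\<^bsub>G\<^esub> \<otimes>\<^bsub>G\<^esub> \<sigma> f"
  have gH: "?g \<in> H"
    using section_square[OF f bar] unfolding r_one[OF section_closed[OF f]] .
  obtain k where k: "k \<in> H" "x f \<otimes>\<^bsub>L\<^esub> x f = \<eta> k"
  proof (rule that)
    note nf = normal_form(1,2)[OF P H.mem_carrier[OF gH]]
    then show "nf_rho G H \<sigma> P ?g \<otimes>\<^bsub>G\<^esub> nf_lambda G H \<sigma> P ?g \<in> H" by (rule H.m_closed)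
    have "\<one>\<^bsub>G\<^esub> \<in> Q (bar f) f"
      using Q f unfolding bar is_double_transversals_def by blast
    moreover have "(bar f, f) \<in> r" using order_cases[OF fE fE] unfolding bar by blast
    ultimately have "x f \<otimes>\<^bsub>L\<^esub> \<eta> \<one>\<^bsub>G\<^esub> \<otimes>\<^bsub>L\<^esub> x f =
        \<eta> (nf_rho G H \<sigma> P ?g) \<otimes>\<^bsub>L\<^esub> x (C ?g) \<otimes>\<^bsub>L\<^esub> \<eta> (nf_lambda G H \<sigma> P ?g)"
      using relation_II[OF fE fE _ _ HOL.refl] by blast
    then show "x f \<otimes>\<^bsub>L\<^esub> x f = \<eta> (nf_rho G H \<sigma> P ?g \<otimes>\<^bsub>G\<^esub> nf_lambda G H \<sigma> P ?g)"
      unfolding C_H[OF gH] x_H \<eta>_one \<eta>_mult[OF nf]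
      by (simp only: L.r_one x_closed[OF f] \<eta>_closed[OF nf(1)])
  qed
  have "x f \<otimes>\<^bsub>L\<^esub> (x f \<otimes>\<^bsub>L\<^esub> \<eta> (inv\<^bsub>G\<^esub> k)) = \<eta> k \<otimes>\<^bsub>L\<^esub> \<eta> (inv\<^bsub>G\<^esub> k)"
    using f k(1) unfolding k(2)[symmetric] by (simp add: L.m_assoc)
  also have "\<dots> = \<one>\<^bsub>L\<^esub>" using k by (simp only: \<eta>_inv L.r_inv \<eta>_closed)
  finally have "inv\<^bsub>L\<^esub> x f = x f \<otimes>\<^bsub>L\<^esub> \<eta> (inv\<^bsub>G\<^esub> k)"
    using L.inv_solve_left[of "x f \<otimes>\<^bsub>L\<^esub> \<eta> (inv\<^bsub>G\<^esub> k)" "x f" "\<one>\<^bsub>L\<^esub>"] f k(1) by simp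
  then show ?thesis using that[OF H.m_inv_closed[OF k(1)]] bar by simp
qed

lemma NF_inv:
  assumes "u \<in> NF"
  shows "inv\<^bsub>L\<^esub> u \<in> NF"
  using assms
proof (rule NF_E)
  fix a f b assume u: "a \<in> H" "f \<in> E" "b \<in> H" "u = \<eta> a \<otimes>\<^bsub>L\<^esub> x f \<otimes>\<^bsub>L\<^esub> \<eta> b"
  obtain c where c: "c \<in> H" "inv\<^bsub>L\<^esub> x f = x (bar f) \<otimes>\<^bsub>L\<^esub> \<eta> c" using inv_x[OF u(2)] .
  have "inv\<^bsub>L\<^esub> u = \<eta> (inv\<^bsub>G\<^esub> b) \<otimes>\<^bsub>L\<^esub> x (bar f) \<otimes>\<^bsub>L\<^esub> \<eta> (c \<otimes>\<^bsub>G\<^esub> inv\<^bsub>G\<^esub> a)"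
    using u c bar_in_E by (simp add: L.inv_mult_group \<eta>_mult \<eta>_inv L.m_assoc)
  then show ?thesis using u c bar_in_E NF_I by simp
qed

lemma NF_x_\<eta>_x:
  assumes f: "f \<in> E" and f': "f' \<in> E" and h: "h \<in> H"
  shows "x f \<otimes>\<^bsub>L\<^esub> \<eta> h \<otimes>\<^bsub>L\<^esub> x f' \<in> NF"
proof (cases "f = H \<or> f' = H")
  case True
  then show ?thesis
  proof
    assume "f = H"
    then show ?thesis
      using NF_I[OF h f' H.one_closed] f' h by (simp add: x_H \<eta>_one)
  next
    assume "f' = H"
    then show ?thesis
      using NF_I[OF H.one_closed f h] f h by (simp add: x_H \<eta>_one)
  qed
next
  case False
  have E: "f \<in> E - {H}" "f' \<in> E - {H}" "bar f \<in> E - {H}" "bar f' \<in> E - {H}"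
    using False f f' bar_in_E bar_eq_H_iff by simp_all
  show ?thesis
  \<comment> \<open>If the order excludes the product itself, it admits the inverse of the product.\<close>
  proof (cases "(bar f, f') \<in> r")
    case True
    show ?thesis by (rule relation_II_NF[OF E(1,2) True h])
  next
    case nle: False
    then have le: "(bar (bar f'), bar f) \<in> r" using order_cases[OF E(3,2)] bar_bar[OF f'] by simp
    obtain c c' where c: "c \<in> H" "inv\<^bsub>L\<^esub> x f = x (bar f) \<otimes>\<^bsub>L\<^esub> \<eta> c"
        "c' \<in> H" "inv\<^bsub>L\<^esub> x f' = x (bar f') \<otimes>\<^bsub>L\<^esub> \<eta> c'"
      by (rule inv_x[OF f], rule inv_x[OF f'])
    \<comment> \<open>By \<open>inv_x\<close> for both factors, the inverse of the product is
      \<open>?v\<close> followed by \<open>\<eta> c\<close>.\<close>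
    let ?v = "x (bar f') \<otimes>\<^bsub>L\<^esub> \<eta> (c' \<otimes>\<^bsub>G\<^esub> inv\<^bsub>G\<^esub> h) \<otimes>\<^bsub>L\<^esub> x (bar f)"
    have "?v \<in> NF" using relation_II_NF[OF E(4,3) le] c h by simp
    then have "\<eta> \<one>\<^bsub>G\<^esub> \<otimes>\<^bsub>L\<^esub> ?v \<otimes>\<^bsub>L\<^esub> \<eta> c \<in> NF" by (rule NF_mult_\<eta>[OF _ H.one_closed c(1)])
    also have "\<eta> \<one>\<^bsub>G\<^esub> \<otimes>\<^bsub>L\<^esub> ?v \<otimes>\<^bsub>L\<^esub> \<eta> c = inv\<^bsub>L\<^esub> (x f \<otimes>\<^bsub>L\<^esub> \<eta> h \<otimes>\<^bsub>L\<^esub> x f')"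
      using c h E by (simp add: L.inv_mult_group \<eta>_mult \<eta>_inv \<eta>_one L.m_assoc)
    finally have "inv\<^bsub>L\<^esub> (inv\<^bsub>L\<^esub> (x f \<otimes>\<^bsub>L\<^esub> \<eta> h \<otimes>\<^bsub>L\<^esub> x f')) \<in> NF" by (rule NF_inv)
    then show ?thesis using f f' h by simp
  qed
qed

text \<open>In a product of two such forms the inner factors from \<open>H\<close> merge into one
  element between \<open>x f\<close> and \<open>x f'\<close>, so \<open>NF_x_\<eta>_x\<close> brings
  the middle into \<open>NF\<close> and \<open>NF_mult_\<eta>\<close> absorbs the outer
  factors.\<close>

lemma subgroup_NF: "subgroup NF L"
proof (rule L.subgroupI)
  show "NF \<subseteq> carrier L" by (rule NF_carrier)
  show "NF \<noteq> {}" using NF_\<eta> H.one_closed by blast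
  show "inv\<^bsub>L\<^esub> u \<in> NF" if "u \<in> NF" for u using NF_inv that .
next
  fix u v assume "u \<in> NF" "v \<in> NF"
  then obtain a f b a' f' b' where m: "a \<in> H" "f \<in> E" "b \<in> H" "a' \<in> H" "f' \<in> E" "b' \<in> H"
    and uv: "u = \<eta> a \<otimes>\<^bsub>L\<^esub> x f \<otimes>\<^bsub>L\<^esub> \<eta> b" "v = \<eta> a' \<otimes>\<^bsub>L\<^esub> x f' \<otimes>\<^bsub>L\<^esub> \<eta> b'"
    by (metis NF_E)
  have "u \<otimes>\<^bsub>L\<^esub> v = \<eta> a \<otimes>\<^bsub>L\<^esub> (x f \<otimes>\<^bsub>L\<^esub> \<eta> (b \<otimes>\<^bsub>G\<^esub> a') \<otimes>\<^bsub>L\<^esub> x f') \<otimes>\<^bsub>L\<^esub> \<eta> b'"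
    using m by (simp add: uv \<eta>_mult L.m_assoc)
  then show "u \<otimes>\<^bsub>L\<^esub> v \<in> NF" using m NF_x_\<eta>_x NF_mult_\<eta> by simp
qed

end

section \<open>The group \<open>H * F\<close>\<close>

lemma group_HF: "group G \<Longrightarrow> subgroup H G \<Longrightarrow> group (HF G H Ep)"
  unfolding HF_def
  by (intro group_free_product group_free_group group.subgroup_imp_group)

context double_coset_section
begin

context
  fixes Ep
  assumes Ep: "is_orientation G H Ep"
begin

abbreviation (input) "K \<equiv> HF G H Ep"
abbreviation (input) "F \<equiv> HF_free H Ep"
abbreviation (input) "inr \<equiv> fp_inr (G\<lparr>carrier := H\<rparr>) F"

interpretation K: group K
  by (rule group_HF[OF is_group H.subgroup_axioms])

interpretation F: group F
  by (rule group_free_group)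

interpretation inr: group_hom F K inr
  unfolding group_hom_def group_hom_axioms_def
  using F.is_group K.is_group fp_inr_hom[OF F.monoid_axioms] by (simp add: HF_def)

lemma HF_H_hom: "HF_H G H Ep \<in> hom (G\<lparr>carrier := H\<rparr>) K"
  using fp_inl_hom[OF group.is_monoid[OF H.subgroup_is_group[OF is_group]]]
  by (simp add: HF_H_def[abs_def] HF_def)

lemma HF_x_H: "HF_x G H Ep H = \<one>\<^bsub>K\<^esub>"
  by (simp add: HF_x_def)

lemma HF_x_Ep: "f \<in> Ep - {H} \<Longrightarrow> HF_x G H Ep f = inr (free_gen (Ep - {H}) f)"
  by (simp add: HF_x_def)

lemma Ep_subset: "Ep \<subseteq> E"
  by (rule orientation_subset[OF Ep])

text \<open>One of \<open>f\<close>, \<open>bar f\<close> lies in \<open>Ep\<close>, and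
  \<open>HF_x\<close> sends the other to the inverse. For self-inverse \<open>f\<close> other than
  \<open>H\<close> the element x_f is a basis element of the free factor and not its own inverse,
  hence the restriction.\<close>

lemma HF_x_bar:
  assumes f: "f \<in> E" and ne: "bar f \<noteq> f"
  shows "HF_x G H Ep (bar f) = inv\<^bsub>K\<^esub> HF_x G H Ep f"
proof -
  have fH: "f \<noteq> H" "bar f \<noteq> H" using ne bar_H bar_eq_H_iff[OF f] by metis+
  show ?thesis
  proof (cases "f \<in> Ep")
    case True
    then have "bar f \<notin> Ep" using bar_notin_orientation[OF Ep True ne] by simp
    then show ?thesis
      using True fH f by (simp add: HF_x_def bar_bar free_gen_closed)
  next
    case False
    then have "bar f \<in> Ep" using notin_orientation[OF Ep f False] by simp
    then show ?thesis
      using False fH f by (simp add: HF_x_def free_gen_closed)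
  qed
qed

lemma HF_x_closed:
  assumes f: "f \<in> E"
  shows "HF_x G H Ep f \<in> carrier K"
proof -
  have Ep_closed: "HF_x G H Ep f \<in> carrier K" if "f \<in> Ep - {H}" for f
    unfolding HF_x_Ep[OF that] using that by (intro inr.hom_closed free_gen_closed)
  consider "f = H" | "f \<in> Ep - {H}" | "f \<notin> Ep" "f \<noteq> H" by blast
  then show ?thesis
  proof cases
    case 1
    then show ?thesis by (simp add: HF_x_H)
  next
    case 2
    then show ?thesis by (rule Ep_closed)
  next
    case 3
    have "bar f \<in> Ep"
      using notin_orientation[OF Ep f] 3 by simp
    then show ?thesis
      using 3 bar_eq_H_iff[OF f] by (simp add: HF_x_def free_gen_closed)
  qed
qed

lemma HF_subgroup_eq:
  assumes U: "subgroup U K"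
    and "\<And>h. h \<in> H \<Longrightarrow> HF_H G H Ep h \<in> U" and x: "\<And>f. f \<in> E \<Longrightarrow> HF_x G H Ep f \<in> U"
  shows "U = carrier K"
  unfolding HF_def
proof (rule free_product_subgroup_eq[OF U[unfolded HF_def]])
  show "fp_inl (G\<lparr>carrier := H\<rparr>) F h \<in> U" if "h \<in> carrier (G\<lparr>carrier := H\<rparr>)" for h
    using assms(2)[of h] that by (simp add: HF_H_def)
  \<comment> \<open>The free factor is treated by pulling \<open>U\<close> back along
    \<open>inr\<close>: the preimage is a subgroup of F containing the basis.\<close>
  have "{b \<in> carrier F. inr b \<in> U} = carrier F"
  proof (rule free_group_subgroup_eq[OF inr.subgroup_vimage[OF U]])
    fix f assume f: "f \<in> Ep - {H}"
    then have "f \<in> E" using Ep_subset by blast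
    then show "free_gen (Ep - {H}) f \<in> {b \<in> carrier F. inr b \<in> U}"
      using x[of f] f free_gen_closed[OF f] HF_x_Ep[OF f] by simp
  qed
  then show "inr b \<in> U" if "b \<in> carrier F" for b using that by blast
qed

text \<open>Two universal properties: that of F gives \<theta> from the values of \<sigma>, and that
  of the free product joins \<theta> with the inclusion of \<open>H\<close>.\<close>

lemma presentation_hom_exists: "\<exists>\<pi>. is_presentation_hom G H \<sigma> Ep \<pi>"
proof -
  have \<sigma>_Ep: "\<sigma> f \<in> carrier G" if "f \<in> Ep - {H}" for f
    using that Ep_subset section_closed by blast
  obtain \<theta> where \<theta>: "\<theta> \<in> hom F G" "\<And>f. f \<in> Ep - {H} \<Longrightarrow> \<theta> (free_gen (Ep - {H}) f) = \<sigma> f"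
  proof (rule free_group_lift[OF is_group \<sigma>_Ep])
    fix \<theta> assume \<theta>: "\<theta> \<in> hom F G" "\<And>f. f \<in> Ep - {H} \<Longrightarrow> \<theta> (free_gen (Ep - {H}) f) = \<sigma> f"
    show thesis by (rule that[OF \<theta>])
  qed
  have "(\<lambda>h. h) \<in> hom (G\<lparr>carrier := H\<rparr>) G" by (rule homI) simp_all
  note lift = free_product_lift[OF H.subgroup_is_group[OF is_group] F.is_group is_group this \<theta>(1)]
  obtain \<pi> where \<pi>: "\<pi> \<in> hom (free_product (G\<lparr>carrier := H\<rparr>) F) G"
    "\<And>h. h \<in> carrier (G\<lparr>carrier := H\<rparr>) \<Longrightarrow> \<pi> (fp_inl (G\<lparr>carrier := H\<rparr>) F h) = h"
    "\<And>b. b \<in> carrier F \<Longrightarrow> \<pi> (inr b) = \<theta> b"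
  proof (rule lift)
    fix \<pi> assume \<pi>: "\<pi> \<in> hom (free_product (G\<lparr>carrier := H\<rparr>) F) G"
      "\<And>h. h \<in> carrier (G\<lparr>carrier := H\<rparr>) \<Longrightarrow> \<pi> (fp_inl (G\<lparr>carrier := H\<rparr>) F h) = h"
      "\<And>b. b \<in> carrier F \<Longrightarrow> \<pi> (inr b) = \<theta> b"
    show thesis by (rule that[OF \<pi>])
  qed
  have "is_presentation_hom G H \<sigma> Ep \<pi>"
    unfolding is_presentation_hom_def
  proof (intro conjI ballI)
    show "\<pi> \<in> hom K G" using \<pi>(1) by (simp only: HF_def)
    show "\<pi> (HF_H G H Ep h) = h" if "h \<in> H" for h using \<pi>(2) that by (simp add: HF_H_def)
    show "\<pi> (HF_x G H Ep f) = \<sigma> f" if "f \<in> Ep - {H}" for f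
      unfolding HF_x_Ep[OF that] \<pi>(3)[OF free_gen_closed[OF that]] by (rule \<theta>(2)[OF that])
  qed
  then show ?thesis by blast
qed

section \<open>Values and surjectivity of the homomorphism to G\<close>

context
  fixes \<pi>
  assumes \<pi>: "is_presentation_hom G H \<sigma> Ep \<pi>"
begin

interpretation \<pi>: group_hom K G \<pi>
  unfolding group_hom_def group_hom_axioms_def
  using K.is_group is_group \<pi> by (simp add: is_presentation_hom_def)

abbreviation (input) "\<eta> \<equiv> HF_H G H Ep"
abbreviation (input) "x \<equiv> HF_x G H Ep"

interpretation \<eta>: group_hom "G\<lparr>carrier := H\<rparr>" K \<eta>
  unfolding group_hom_def group_hom_axioms_def
  using H.subgroup_is_group[OF is_group] K.is_group HF_H_hom by blast

lemma HF_H_closed: "h \<in> H \<Longrightarrow> \<eta> h \<in> carrier K"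
  using \<eta>.hom_closed by simp

lemma \<pi>_\<eta>: "h \<in> H \<Longrightarrow> \<pi> (\<eta> h) = h"
  using \<pi> by (simp add: is_presentation_hom_def)

text \<open>The values are prescribed on \<open>Ep - {H}\<close> only. Outside \<open>Ep\<close>
  they follow because passing to \<open>bar f\<close> inverts both x_f and \<sigma>(f).\<close>

lemma \<pi>_x:
  assumes f: "f \<in> E"
  shows "\<pi> (x f) = \<sigma> f"
proof -
  have Ep_x: "\<pi> (x f) = \<sigma> f" if "f \<in> Ep" for f
    using that \<pi> by (cases "f = H") (simp_all add: HF_x_H section_H is_presentation_hom_def)
  show ?thesis
  proof (cases "f \<in> Ep")
    case True
    then show ?thesis by (rule Ep_x)
  next
    case False
    note bar = notin_orientation[OF Ep f False]
    have "x (bar f) = inv\<^bsub>K\<^esub> x f" by (rule HF_x_bar[OF f bar(2)])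
    then have "inv\<^bsub>G\<^esub> \<pi> (x f) = inv\<^bsub>G\<^esub> \<sigma> f"
      using Ep_x[OF bar(1)] section_bar[OF f bar(2)] \<pi>.hom_inv[OF HF_x_closed[OF f]] by simp
    then show ?thesis
      using \<pi>.hom_closed[OF HF_x_closed[OF f]] section_closed[OF f] by (metis inv_inv)
  qed
qed

lemma image_\<pi>: "\<pi> ` carrier K = carrier G"
proof
  show "\<pi> ` carrier K \<subseteq> carrier G" by auto
  show "carrier G \<subseteq> \<pi> ` carrier K"
  proof
    fix g assume g: "g \<in> carrier G"
    then obtain a b where ab: "a \<in> H" "b \<in> H" "g = a \<otimes> \<sigma> (C g) \<otimes> b" by (rule decomposition)
    note m = HF_H_closed[OF ab(1)] HF_H_closed[OF ab(2)] HF_x_closed[OF C_in_E[OF g]]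
    have "\<pi> (\<eta> a \<otimes>\<^bsub>K\<^esub> x (C g) \<otimes>\<^bsub>K\<^esub> \<eta> b) = a \<otimes> \<sigma> (C g) \<otimes> b"
      using m ab(1,2) C_in_E[OF g] by (simp add: \<pi>_\<eta> \<pi>_x)
    with ab(3) show "g \<in> \<pi> ` carrier K" using m by (metis K.m_closed imageI)
  qed
qed

section \<open>The kernel of the homomorphism to G\<close>

context
  fixes P Q r
  assumes P: "is_transversals G H \<sigma> P"
    and Q: "is_double_transversals G H \<sigma> Q"
    and order: "linear_order_on (E - {H}) r"
begin

abbreviation (input) "R \<equiv> relators_I G H \<sigma> Ep \<union> relators_II G H \<sigma> P Q Ep r"

lemma relator_in_kernel:
  assumes "u \<in> carrier K" "v \<in> carrier K" "\<pi> u = \<pi> v"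
  shows "u \<otimes>\<^bsub>K\<^esub> inv\<^bsub>K\<^esub> v \<in> kernel K G \<pi>"
  using assms by (simp add: kernel_def)

lemma relators_I_kernel: "relators_I G H \<sigma> Ep \<subseteq> kernel K G \<pi>"
proof
  fix z assume "z \<in> relators_I G H \<sigma> Ep"
  then obtain f h where fh: "f \<in> Ep - {H}" "h \<in> stab f"
    and z: "z = (\<eta> h \<otimes>\<^bsub>K\<^esub> x f) \<otimes>\<^bsub>K\<^esub> inv\<^bsub>K\<^esub> (x f \<otimes>\<^bsub>K\<^esub> \<eta> (iota f h))"
    unfolding relators_I_def Let_def by (elim CollectE exE conjE)
  have f: "f \<in> E" using fh(1) Ep_subset by blast
  have h: "h \<in> H" "iota f h \<in> H" using fh(2) f by (simp_all add: mem_stab)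
  show "z \<in> kernel K G \<pi>"
    unfolding z
  proof (rule relator_in_kernel)
    show "\<pi> (\<eta> h \<otimes>\<^bsub>K\<^esub> x f) = \<pi> (x f \<otimes>\<^bsub>K\<^esub> \<eta> (iota f h))"
      using f h by (simp add: HF_x_closed HF_H_closed \<pi>_x \<pi>_\<eta>)
        (simp add: dc_iota_def m_assoc inv_mult_cancel_left)
  qed (use f h in \<open>simp_all add: HF_x_closed HF_H_closed\<close>)
qed

text \<open>Under \<pi> the left side of the relation becomes \<open>g\<close> and the right side
  becomes the normal form of \<open>g\<close>.\<close>

lemma relators_II_kernel: "relators_II G H \<sigma> P Q Ep r \<subseteq> kernel K G \<pi>"
proof
  fix z assume "z \<in> relators_II G H \<sigma> P Q Ep r"
  then obtain f f' h g where f: "f \<in> E - {H}" and f': "f' \<in> E - {H}"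
    and hQ: "h \<in> Q (bar f) f'" and g: "g = \<sigma> f \<otimes> h \<otimes> \<sigma> f'"
    and z: "z = (x f \<otimes>\<^bsub>K\<^esub> \<eta> h \<otimes>\<^bsub>K\<^esub> x f') \<otimes>\<^bsub>K\<^esub>
      inv\<^bsub>K\<^esub> (\<eta> (nf_rho G H \<sigma> P g) \<otimes>\<^bsub>K\<^esub> x (C g) \<otimes>\<^bsub>K\<^esub> \<eta> (nf_lambda G H \<sigma> P g))"
    unfolding relators_II_def Let_def by (elim CollectE exE conjE)
  have fE: "f \<in> E" "f' \<in> E" "bar f \<in> E"
    using f f' by (simp_all add: bar_in_E)
  have h: "h \<in> H" by (rule subsetD[OF double_transversals_subset[OF Q fE(3,2)] hQ])
  have gG: "g \<in> carrier G" using fE h g by simp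
  note nf = normal_form[OF P gG]
  show "z \<in> kernel K G \<pi>"
    unfolding z
  proof (rule relator_in_kernel)
    have "\<pi> (x f \<otimes>\<^bsub>K\<^esub> \<eta> h \<otimes>\<^bsub>K\<^esub> x f') = g"
      using fE h by (simp add: HF_x_closed HF_H_closed \<pi>_x \<pi>_\<eta> g)
    also have "\<dots> = \<pi> (\<eta> (nf_rho G H \<sigma> P g) \<otimes>\<^bsub>K\<^esub> x (C g) \<otimes>\<^bsub>K\<^esub> \<eta> (nf_lambda G H \<sigma> P g))"
      using nf(1,2) C_in_E[OF gG]
      by (simp only: HF_x_closed HF_H_closed \<pi>_x \<pi>_\<eta> \<pi>.hom_mult K.m_closed nf(3)[symmetric])
    finally show "\<pi> (x f \<otimes>\<^bsub>K\<^esub> \<eta> h \<otimes>\<^bsub>K\<^esub> x f') =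
        \<pi> (\<eta> (nf_rho G H \<sigma> P g) \<otimes>\<^bsub>K\<^esub> x (C g) \<otimes>\<^bsub>K\<^esub> \<eta> (nf_lambda G H \<sigma> P g))" .
  qed (use fE h nf(1,2) C_in_E[OF gG] in \<open>simp_all add: HF_x_closed HF_H_closed\<close>)
qed

text \<open>In \<open>K Mod N\<close> the relators are trivial, so the normal forms there constitute
  a subgroup. Its preimage in \<open>K\<close> contains all generators and hence every
  \<open>u\<close>.\<close>

lemma coset_normal_form:
  assumes N: "N \<lhd> K" and R: "R \<subseteq> N" and u: "u \<in> carrier K"
  obtains a f b where "a \<in> H" "f \<in> E" "b \<in> H"
    "N #>\<^bsub>K\<^esub> u = N #>\<^bsub>K\<^esub> (\<eta> a \<otimes>\<^bsub>K\<^esub> x f \<otimes>\<^bsub>K\<^esub> \<eta> b)"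
proof -
  interpret N: normal N K by fact
  define q where "q u = N #>\<^bsub>K\<^esub> u" for u
  have group_L: "group (K Mod N)" by (rule N.factorgroup_is_group)
  interpret q: group_hom K "K Mod N" q
    unfolding group_hom_def group_hom_axioms_def q_def[abs_def]
    using K.is_group group_L N.r_coset_hom_Mod by blast
  have q_mult: "q (v \<otimes>\<^bsub>K\<^esub> w) = q v \<otimes>\<^bsub>K Mod N\<^esub> q w" if "v \<in> carrier K" "w \<in> carrier K" for v w
    using q.hom_mult that .
  \<comment> \<open>Turns relators back into relations: cosets of v and w agree as soon as v w^-1
    lies in \<open>N\<close>.\<close>
  have q_eq: "q v = q w" if "v \<in> carrier K" "w \<in> carrier K" "v \<otimes>\<^bsub>K\<^esub> inv\<^bsub>K\<^esub> w \<in> R" for v w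
    unfolding q_def using N.rcos_eq_iff that R by blast
  interpret rel: double_coset_relations G H \<sigma> "K Mod N" P Q Ep r "\<lambda>h. q (\<eta> h)" "\<lambda>f. q (x f)"
  proof (intro double_coset_relations.intro double_coset_relations_axioms.intro
      double_coset_section_axioms group_L P Q Ep order)
    show "(\<lambda>h. q (\<eta> h)) \<in> hom (G\<lparr>carrier := H\<rparr>) (K Mod N)"
      using Group.hom_compose[OF HF_H_hom q.homh] by (simp add: comp_def)
    show "q (x f) \<in> carrier (K Mod N)" if "f \<in> E" for f
      using q.hom_closed HF_x_closed[OF that] .
    show "q (x H) = \<one>\<^bsub>K Mod N\<^esub>" unfolding HF_x_H by (rule q.hom_one)
    show "q (x (bar f)) = inv\<^bsub>K Mod N\<^esub> q (x f)" if "f \<in> E" "bar f \<noteq> f" for f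
      unfolding HF_x_bar[OF that] by (rule q.hom_inv[OF HF_x_closed[OF that(1)]])
  next
    fix f h assume f: "f \<in> Ep - {H}" and h: "h \<in> stab f"
    have fE: "f \<in> E" using f Ep_subset by blast
    have m: "\<eta> h \<in> carrier K" "\<eta> (iota f h) \<in> carrier K" "x f \<in> carrier K"
      using h fE by (simp_all add: mem_stab HF_H_closed HF_x_closed)
    have "(\<eta> h \<otimes>\<^bsub>K\<^esub> x f) \<otimes>\<^bsub>K\<^esub> inv\<^bsub>K\<^esub> (x f \<otimes>\<^bsub>K\<^esub> \<eta> (iota f h)) \<in> R"
      unfolding relators_I_def Let_def
      by (intro UnI1 CollectI exI[of _ f] exI[of _ h] conjI HOL.refl f h)
    then have "q (\<eta> h \<otimes>\<^bsub>K\<^esub> x f) = q (x f \<otimes>\<^bsub>K\<^esub> \<eta> (iota f h))"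
      using m by (intro q_eq K.m_closed)
    then show "q (\<eta> h) \<otimes>\<^bsub>K Mod N\<^esub> q (x f) = q (x f) \<otimes>\<^bsub>K Mod N\<^esub> q (\<eta> (iota f h))"
      by (simp only: q_mult m)
  next
    fix f f' h g
    assume f: "f \<in> E - {H}" and f': "f' \<in> E - {H}" and le: "(bar f, f') \<in> r"
      and hQ: "h \<in> Q (bar f) f'" and g: "g = \<sigma> f \<otimes> h \<otimes> \<sigma> f'"
    let ?\<rho> = "nf_rho G H \<sigma> P g" and ?l = "nf_lambda G H \<sigma> P g"
    have fE: "f \<in> E" "f' \<in> E" "bar f \<in> E"
    using f f' by (simp_all add: bar_in_E)
    have h: "h \<in> H" by (rule subsetD[OF double_transversals_subset[OF Q fE(3,2)] hQ])
    have gG: "g \<in> carrier G" using fE h g by simp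
    note nf = normal_form(1,2)[OF P gG]
    have m: "\<eta> h \<in> carrier K" "\<eta> ?\<rho> \<in> carrier K" "\<eta> ?l \<in> carrier K"
      "x f \<in> carrier K" "x f' \<in> carrier K" "x (C g) \<in> carrier K"
      using h fE nf C_in_E[OF gG] by (simp_all add: HF_H_closed HF_x_closed)
    have "(x f \<otimes>\<^bsub>K\<^esub> \<eta> h \<otimes>\<^bsub>K\<^esub> x f') \<otimes>\<^bsub>K\<^esub>
        inv\<^bsub>K\<^esub> (\<eta> ?\<rho> \<otimes>\<^bsub>K\<^esub> x (C g) \<otimes>\<^bsub>K\<^esub> \<eta> ?l) \<in> relators_II G H \<sigma> P Q Ep r"
      unfolding relators_II_def Let_def
      by (intro CollectI exI[of _ f] exI[of _ f'] exI[of _ h] exI[of _ g] conjI HOL.refl f f' le hQ g)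
    then have "q (x f \<otimes>\<^bsub>K\<^esub> \<eta> h \<otimes>\<^bsub>K\<^esub> x f') = q (\<eta> ?\<rho> \<otimes>\<^bsub>K\<^esub> x (C g) \<otimes>\<^bsub>K\<^esub> \<eta> ?l)"
      using m by (intro q_eq K.m_closed UnI2)
    then show "q (x f) \<otimes>\<^bsub>K Mod N\<^esub> q (\<eta> h) \<otimes>\<^bsub>K Mod N\<^esub> q (x f') =
        q (\<eta> ?\<rho>) \<otimes>\<^bsub>K Mod N\<^esub> q (x (C g)) \<otimes>\<^bsub>K Mod N\<^esub> q (\<eta> ?l)"
      by (simp only: q_mult m K.m_closed)
  qed
  have "{v \<in> carrier K. q v \<in> rel.NF} = carrier K"
    by (rule HF_subgroup_eq[OF q.subgroup_vimage[OF rel.subgroup_NF]])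
      (simp_all add: rel.NF_\<eta> rel.NF_x HF_H_closed HF_x_closed)
  then have "q u \<in> rel.NF" using u by blast
  then obtain a f b where afb: "a \<in> H" "f \<in> E" "b \<in> H"
    and eq: "q u = q (\<eta> a) \<otimes>\<^bsub>K Mod N\<^esub> q (x f) \<otimes>\<^bsub>K Mod N\<^esub> q (\<eta> b)" by (rule rel.NF_E)
  have m: "\<eta> a \<in> carrier K" "x f \<in> carrier K" "\<eta> b \<in> carrier K"
    using afb by (simp_all add: HF_H_closed HF_x_closed)
  have "q u = q (\<eta> a \<otimes>\<^bsub>K\<^esub> x f \<otimes>\<^bsub>K\<^esub> \<eta> b)"
    unfolding eq by (simp only: q_mult m K.m_closed)
  then show ?thesis using that afb unfolding q_def by blast
qed

lemma kernel_\<pi>: "kernel K G \<pi> = normal_closure K R"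
proof
  have R_kernel: "R \<subseteq> kernel K G \<pi>" using relators_I_kernel relators_II_kernel by blast
  show N_kernel: "normal_closure K R \<subseteq> kernel K G \<pi>"
    by (rule normal_closure_least[OF \<pi>.normal_kernel R_kernel])
  show "kernel K G \<pi> \<subseteq> normal_closure K R"
  proof
    have N: "normal_closure K R \<lhd> K"
      using R_kernel by (intro K.normal_normal_closure) (auto simp: kernel_def)
    interpret N: normal "normal_closure K R" K by (rule N)
    fix u assume "u \<in> kernel K G \<pi>"
    then have u: "u \<in> carrier K" "\<pi> u = \<one>" by (auto simp: kernel_def)
    obtain a f b where afb: "a \<in> H" "f \<in> E" "b \<in> H" and
      eq: "normal_closure K R #>\<^bsub>K\<^esub> u =
        normal_closure K R #>\<^bsub>K\<^esub> (\<eta> a \<otimes>\<^bsub>K\<^esub> x f \<otimes>\<^bsub>K\<^esub> \<eta> b)"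
      using coset_normal_form[OF N normal_closure_superset u(1)] .
    let ?w = "\<eta> a \<otimes>\<^bsub>K\<^esub> x f \<otimes>\<^bsub>K\<^esub> \<eta> b"
    note m = HF_H_closed[OF afb(1)] HF_x_closed[OF afb(2)] HF_H_closed[OF afb(3)]
    have w: "?w \<in> carrier K" using m by simp
    have "u \<otimes>\<^bsub>K\<^esub> inv\<^bsub>K\<^esub> ?w \<in> normal_closure K R" using N.rcos_eq_iff[OF u(1) w] eq by simp
    \<comment> \<open>As \<open>?w\<close> differs from \<open>u\<close> by an element of the
      kernel, \<pi> kills \<open>?w\<close> as well.\<close>
    then have "\<pi> (u \<otimes>\<^bsub>K\<^esub> inv\<^bsub>K\<^esub> ?w) = \<one>" using N_kernel by (auto simp: kernel_def)
    then have "inv (\<pi> ?w) = \<one>"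
      unfolding \<pi>.hom_mult[OF u(1) K.inv_closed[OF w]] \<pi>.hom_inv[OF w] u(2)
      using \<pi>.hom_closed[OF w] l_one inv_closed by metis
    then have "\<pi> ?w = \<one>" using \<pi>.hom_closed[OF w] by (metis inv_inv inv_one)
    then have one: "a \<otimes> \<sigma> f \<otimes> b = \<one>" using m afb by (simp add: \<pi>_\<eta> \<pi>_x)
    \<comment> \<open>The double coset of the image recovers \<open>f\<close>, and the double coset
      of 1 is \<open>H\<close>.\<close>
    have "C (a \<otimes> \<sigma> f \<otimes> b) = f" using C_eq[of "\<sigma> f" a b] C_section afb by simp
    then have fH: "f = H" using one C_H[OF H.one_closed] by simp
    then have ab: "a \<otimes> b = \<one>" using one afb by (simp add: section_H)
    have "?w = \<eta> a \<otimes>\<^bsub>K\<^esub> \<eta> b" using m by (simp add: fH HF_x_H)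
    also have "\<dots> = \<eta> (a \<otimes> b)" using \<eta>.hom_mult[of a b] afb by simp
    also have "\<dots> = \<one>\<^bsub>K\<^esub>" using \<eta>.hom_one ab by simp
    \<comment> \<open>With \<open>?w\<close> trivial, equality of the cosets of \<open>u\<close> and
      \<open>?w\<close> says that \<open>u\<close> lies in the normal closure.\<close>
    finally show "u \<in> normal_closure K R"
      using N.rcos_eq_iff[OF u(1) w] eq u(1) by simp
  qed
qed

end

end

end

end

theorem theorem2p1:
  fixes G :: "('g, 'm) monoid_scheme"
    and \<Omega> :: "'w set" and \<phi> :: "'g \<Rightarrow> 'w \<Rightarrow> 'w" and \<omega>\<^sub>0 :: 'w
    and H :: "'g set"
    and \<sigma> :: "'g set \<Rightarrow> 'g"
    and P :: "'g set \<Rightarrow> 'g set"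
    and Q :: "'g set \<Rightarrow> 'g set \<Rightarrow> 'g set"
    and Ep :: "'g set set"
    and r :: "('g set \<times> 'g set) set"
  assumes "transitive_action G \<Omega> \<phi>" and "\<omega>\<^sub>0 \<in> \<Omega>"
    and "H = stabilizer G \<phi> \<omega>\<^sub>0"
    and "is_section G H \<sigma>"
    and "is_transversals G H \<sigma> P"
    and "is_double_transversals G H \<sigma> Q"
    and "is_orientation G H Ep"
    and "linear_order_on (double_cosets G H - {H}) r"
  shows "(\<exists>\<pi>. is_presentation_hom G H \<sigma> Ep \<pi>) \<and>
    (\<forall>\<pi>. is_presentation_hom G H \<sigma> Ep \<pi> \<longrightarrow>
      \<pi> ` carrier (HF G H Ep) = carrier G \<and>
      kernel (HF G H Ep) G \<pi> =
        normal_closure (HF G H Ep) (relators_I G H \<sigma> Ep \<union> relators_II G H \<sigma> P Q Ep r))"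
proof -
  \<comment> \<open>The action supplies the group structure of \<open>G\<close> and, through the
    stabiliser of the base point, the subgroup \<open>H\<close>.\<close>
  interpret A: transitive_action G \<Omega> \<phi> by fact
  have G: "group G" using A.group_hom by (simp add: group_hom_def)
  have H: "subgroup H G" unfolding assms(3) by (rule A.stabilizer_subgroup[OF assms(2)])
  interpret double_coset_section G H \<sigma>
    using G H assms(4) by (simp add: double_coset_section_def double_coset_section_axioms_def)
  show ?thesis
    using presentation_hom_exists[OF assms(7)] image_\<pi>[OF assms(7)]
      kernel_\<pi>[OF assms(7) _ assms(5,6,8)] by simp
qed

end
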